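(* Let $q\ge5$ be a power of $3$. Then $\Lambda_{\mathrm{EA},3_{\mathcal C}}=q-2$, $\Lambda_{\mathrm{EA},\overline{1_{\mathcal C}}}=q$, $\Lambda_{\mathrm{EA},0_{\mathcal C}}=q+1$; $\Lambda_{\mathrm{En}\Gamma,3_{\mathcal C}}=q^2-3q+3$, $\Lambda_{\mathrm{En}\Gamma,\overline{1_{\mathcal C}}}=q^2-q-1$, $\Lambda_{\mathrm{En}\Gamma,0_{\mathcal C}}=q^2$; $\Pi_{3_{\mathcal C},\mathrm{EA}}=\frac{q(q-2)}{6(q+1)}$, $\Pi_{\overline{1_{\mathcal C}},\mathrm{EA}}=\frac{q^2}{2(q+1)}$, $\Pi_{0_{\mathcal C},\mathrm{EA}}=\frac{q}{3}$; $\Pi_{3_{\mathcal C},\mathrm{En}\Gamma}=\frac{q^2-3q+3}{6(q-1)}$, $\Pi_{\overline{1_{\mathcal C}},\mathrm{En}\Gamma}=\frac{q^2-q-1}{2(q-1)}$, $\Pi_{0_{\mathcal C},\mathrm{En}\Gamma}=\frac{q^2}{3(q-1)}$.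
   Context: Let $\mathrm{PG}(3,q)$ have points $\mathbf{P}(x_0,x_1,x_2,x_3)$; put $P(t)=\mathbf{P}(t^3,t^2,t,1)$ ($t\in\mathbb{F}_q$), $P(\infty)=\mathbf{P}(1,0,0,0)$, $\mathcal{C}=\{P(t):t\in\mathbb{F}_q\cup\{\infty\}\}$ the twisted cubic, $G_q$ the group of projectivities fixing $\mathcal C$. Write $\boldsymbol{\pi}(c_0,c_1,c_2,c_3)$ for the plane $c_0x_0+c_1x_1+c_2x_2+c_3x_3=0$. $\Gamma$-planes: the osculating planes $\boldsymbol{\pi}(1,-3t,3t^2,-t^3)$ ($t\in\mathbb{F}_q$) and $\boldsymbol{\pi}(0,0,0,1)$; for $q\equiv0\pmod3$ they share a common line, the axis $\mathrm{A}$. A $d_{\mathcal C}$-plane ($d\in\{0,3\}$) contains exactly $d$ points of $\mathcal C$; a $\overline{1_{\mathcal C}}$-plane is a non-$\Gamma$-plane containing exactly one point of $\mathcal C$ (each type is a $G_q$-orbit for $q\ge5$). An EA-line is a line with no point of $\mathcal C$, different from $\mathrm{A}$, meeting $\mathrm{A}$. An imaginary chord is the line joining $P(s),P(s^q)$, $s\in\mathbb{F}_{q^2}\setminus\mathbb{F}_q$. An En$\Gamma$-line is a line with no point of $\mathcal C$, lying in no $\Gamma$-plane, which is not an imaginary chord. Notation: $\Lambda_{\lambda,\pi}$ is the number of $\lambda$-lines in a $\pi$-plane; $\Pi_{\pi,\lambda}$ is the average, over all $\lambda$-lines, of the number of $\pi$-planes through the line. *)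

theory Defs
  imports "HOL-Analysis.Analysis" "HOL-Algebra.Algebraic_Closure_Type"
begin

text \<open>
  Points, lines and planes of PG(3,q) are the linear subspaces of dimension 1, 2 and 3 of the
  space \<open>'a^4\<close> over a finite field \<open>'a\<close>; incidence is inclusion. The homogeneous coordinates
  \<open>x\<^sub>0, ..., x\<^sub>3\<close> are the components with indices \<open>1, ..., 4\<close>.
\<close>

lemma vector_4 [simp]:
  "(vector [w, x, y, z] :: 'a::zero ^ 4) $ 1 = w"
  "(vector [w, x, y, z] :: 'a::zero ^ 4) $ 2 = x"
  "(vector [w, x, y, z] :: 'a::zero ^ 4) $ 3 = y"
  "(vector [w, x, y, z] :: 'a::zero ^ 4) $ 4 = z"
  unfolding vector_def by simp_all

definition proj_points :: "('a::field ^ 4) set set" where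
  "proj_points = {p. vec.subspace p \<and> vec.dim p = 1}"

definition proj_lines :: "('a::field ^ 4) set set" where
  "proj_lines = {l. vec.subspace l \<and> vec.dim l = 2}"

definition proj_planes :: "('a::field ^ 4) set set" where
  "proj_planes = {\<pi>. vec.subspace \<pi> \<and> vec.dim \<pi> = 3}"

definition proj_point :: "'a::field \<Rightarrow> 'a \<Rightarrow> 'a \<Rightarrow> 'a \<Rightarrow> ('a ^ 4) set" where
  "proj_point x0 x1 x2 x3 = vec.span {vector [x0, x1, x2, x3]}"

definition proj_plane :: "'a::field \<Rightarrow> 'a \<Rightarrow> 'a \<Rightarrow> 'a \<Rightarrow> ('a ^ 4) set" where
  "proj_plane c0 c1 c2 c3 = {x. c0 * x $ 1 + c1 * x $ 2 + c2 * x $ 3 + c3 * x $ 4 = 0}"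

definition twisted_cubic :: "('a::field ^ 4) set set" where
  "twisted_cubic = insert (proj_point 1 0 0 0) (range (\<lambda>t. proj_point (t ^ 3) (t\<^sup>2) t 1))"

definition Gamma_planes :: "('a::field ^ 4) set set" where
  "Gamma_planes = insert (proj_plane 0 0 0 1)
     (range (\<lambda>t. proj_plane 1 (- 3 * t) (3 * t\<^sup>2) (- (t ^ 3))))"

text \<open>In characteristic 3 this intersection is the line \<open>x\<^sub>0 = x\<^sub>3 = 0\<close>.\<close>

definition Gamma_axis :: "('a::field ^ 4) set" where
  "Gamma_axis = \<Inter> Gamma_planes"

definition d_planes :: "nat \<Rightarrow> ('a::{field,finite} ^ 4) set set" where
  "d_planes d = {\<pi> \<in> proj_planes. card {p \<in> twisted_cubic. p \<subseteq> \<pi>} = d}"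

definition one_bar_planes :: "('a::{field,finite} ^ 4) set set" where
  "one_bar_planes = d_planes 1 - Gamma_planes"

definition external_lines :: "('a::field ^ 4) set set" where
  "external_lines = {l \<in> proj_lines. \<not> (\<exists>p \<in> twisted_cubic. p \<subseteq> l)}"

definition EA_lines :: "('a::field ^ 4) set set" where
  "EA_lines = {l \<in> external_lines. l \<noteq> Gamma_axis \<and>
     (\<exists>p \<in> proj_points. p \<subseteq> l \<and> p \<subseteq> Gamma_axis)}"

text \<open>
  The quadratic extension of the ground field is realised inside its algebraic closure, as the
  set of solutions of \<open>s^(q\<^sup>2) = s\<close>; the ground field itself is \<open>range to_ac\<close>. The line of
  PG(3,q) joining \<open>P(s)\<close> and \<open>P(s^q)\<close> consists of the vectors over the ground field that lie
  in the span of the two conjugate points.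
\<close>

definition quadratic_extension :: "'a::{field,finite} alg_closure set" where
  "quadratic_extension = {s. s ^ (CARD('a)\<^sup>2) = s}"

definition imaginary_chord :: "'a::{field,finite} alg_closure \<Rightarrow> ('a ^ 4) set" where
  "imaginary_chord s = {v. (\<chi> i. to_ac (v $ i)) \<in>
     vec.span (proj_point (s ^ 3) (s\<^sup>2) s 1 \<union>
       (let s' = s ^ CARD('a) in proj_point (s' ^ 3) (s'\<^sup>2) s' 1))}"

definition imaginary_chords :: "('a::{field,finite} ^ 4) set set" where
  "imaginary_chords = imaginary_chord ` (quadratic_extension - range to_ac)"

definition EnGamma_lines :: "('a::{field,finite} ^ 4) set set" where
  "EnGamma_lines = {l \<in> external_lines.
     \<not> (\<exists>\<pi> \<in> Gamma_planes. l \<subseteq> \<pi>) \<and> l \<notin> imaginary_chords}"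

definition lines_in :: "('a ^ 4) set set \<Rightarrow> ('a ^ 4) set \<Rightarrow> nat" where
  "lines_in ls \<pi> = card {l \<in> ls. l \<subseteq> \<pi>}"

definition planes_through :: "('a ^ 4) set set \<Rightarrow> ('a ^ 4) set \<Rightarrow> nat" where
  "planes_through ps l = card {\<pi> \<in> ps. l \<subseteq> \<pi>}"

definition avg_planes_through :: "('a ^ 4) set set \<Rightarrow> ('a ^ 4) set set \<Rightarrow> real" where
  "avg_planes_through ps ls = (\<Sum>l \<in> ls. real (planes_through ps l)) / real (card ls)"

end

(*
  In characteristic 3 the osculating planes are exactly the q + 1 planes through the axis, so an
  external line other than the axis is an EA-line iff it lies in one of them; the remaining external
  lines are the imaginary chords and the EnGamma-lines.

  No plane contains more than three points of the cubic, hence any k <= 3 of its points span a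
  subspace of dimension k. Counting the incidences between k-subsets of the cubic and planes, or
  lines inside a fixed plane, therefore gives the binomial moments of the number of cubic points,
  and from them the number of planes of each type and of external lines in a plane or in the space.
  The EA-lines in a plane are the external lines through the point where the plane meets the axis.

  An imaginary chord corresponds to an irreducible quadratic dividing the cubic form of a plane
  through it. So all planes through it have exactly one cubic point and do not osculate, and
  conversely every such plane contains exactly one imaginary chord. The averages follow by counting
  incident pairs of lines and planes.
*)

theory Submission
  imports Defs
begin

no_notation fps_nth (infixl "$" 75) \<comment> \<open>would make vector components ambiguous\<close>

section \<open>Counting subspaces over a finite field\<close>

text \<open>Characteristic 3 acts through cubing. It is bijective on the field, so the osculating
  planes \<open>x0 = t^3 x3\<close> and \<open>x3 = 0\<close> exhaust the pencil through the axis;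
  and \<open>(x - r)^3 = x^3 - r^3\<close> has no middle terms, so a plane whose cubic form has a
  triple root is osculating. Hence in a non-osculating plane with a single cubic point, the
  quadratic left after removing the linear factor cannot split: both its roots would fall on that
  point.

  Imaginary chords are defined over the algebraic closure, whereas the counts live over the ground
  field. They are brought down by the trace \<open>T\<close> and the norm \<open>N\<close> of
  \<open>s\<close>, which are Frobenius-invariant: a chord becomes the solution space of a linear
  recurrence with characteristic polynomial \<open>x^2 - T x + N\<close>.

  A line count depends on the plane only through its numbers of cubic points and of imaginary
  chords. It is therefore constant on each plane type, and this fixes the total number of incidences
  even if the number of planes varies from line to line.\<close>

lemma card_span_insert:
  fixes a :: "'a::{field,finite} ^ 'n"
  assumes "a \<notin> vec.span B"
  shows "card (vec.span (insert a B)) = CARD('a) * card (vec.span B)"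
proof -
  let ?f = "\<lambda>(k, x). k *s a + x"
  \<comment> \<open>A nonzero multiple of \<open>a\<close> in the span would put \<open>a\<close>
    itself there. This makes the representation \<open>k *s a + x\<close> unique.\<close>
  have scale: "k = 0" if "k *s a \<in> vec.span B" for k
    using assms that vec.span_scale[of "k *s a" B "inverse k"] by (cases "k = 0") auto
  have "inj_on ?f (UNIV \<times> vec.span B)"
  proof (rule inj_onI, clarsimp)
    fix k x l y
    assume xy: "x \<in> vec.span B" "y \<in> vec.span B" and eq: "k *s a + x = l *s a + y"
    have "(k - l) *s a = y - x"
      using eq by (simp add: vec.scale_left_diff_distrib algebra_simps)
    then have "(k - l) *s a \<in> vec.span B"
      using xy by (simp add: vec.span_diff)
    from scale[OF this] have "k = l" by simp
    with eq show "k = l \<and> x = y" by simp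
  qed
  moreover have "?f ` (UNIV \<times> vec.span B) = vec.span (insert a B)"
  proof (intro equalityI subsetI)
    fix x assume "x \<in> vec.span (insert a B)"
    then obtain k where "x - k *s a \<in> vec.span B"
      unfolding vec.span_insert by blast
    then show "x \<in> ?f ` (UNIV \<times> vec.span B)"
      by (intro image_eqI[of _ _ "(k, x - k *s a)"]) auto
  next
    fix x assume "x \<in> ?f ` (UNIV \<times> vec.span B)"
    then obtain k y where "x = k *s a + y" "y \<in> vec.span B" by auto
    then show "x \<in> vec.span (insert a B)"
      unfolding vec.span_insert by (auto intro!: exI[of _ k])
  qed
  ultimately have "card (vec.span (insert a B)) = card ((UNIV :: 'a set) \<times> vec.span B)"
    by (metis card_image)
  then show ?thesis by (simp only: card_cartesian_product)
qed

lemma card_subspace: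
  fixes S :: "('a::{field,finite} ^ 'n) set"
  assumes "vec.subspace S"
  shows "card S = CARD('a) ^ vec.dim S"
proof -
  obtain B where B: "B \<subseteq> S" "vec.independent B" "S \<subseteq> vec.span B" "card B = vec.dim S"
    using vec.basis_exists by blast
  have "finite B" by (rule finite)
  then have "card (vec.span B) = CARD('a) ^ card B"
    using B(2) by induction (auto simp: vec.independent_insert card_span_insert split: if_splits)
  moreover have "vec.span B = S"
    using B assms by (metis vec.span_eq_iff vec.span_mono subset_antisym)
  ultimately show ?thesis using B by simp
qed

lemma point_eq_span:
  fixes p :: "('a::field ^ 'n) set"
  assumes "vec.subspace p" "vec.dim p = 1" "x \<in> p" "x \<noteq> 0"
  shows "p = vec.span {x}"
  using assms vec.subspace_dim_equal[of "vec.span {x}" p] vec.span_minimal[of "{x}" p] by simp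

text \<open>For \<open>U \<subseteq> V\<close> these are the subspaces of dimension
  \<open>m - dim U\<close> of the quotient \<open>V / U\<close>; their numbers are Gaussian
  binomials.\<close>

definition subspaces_between ::
    "('a::field ^ 'n) set \<Rightarrow> ('a ^ 'n) set \<Rightarrow> nat \<Rightarrow> ('a ^ 'n) set set" where
  "subspaces_between U V m = {W. vec.subspace W \<and> vec.dim W = m \<and> U \<subseteq> W \<and> W \<subseteq> V}"

lemma span_insert_between:
  assumes "vec.subspace U" "vec.subspace V" "U \<subseteq> V" "x \<in> V - U"
  shows "vec.span (insert x U) \<in> subspaces_between U V (Suc (vec.dim U))"
proof -
  have "vec.span (insert x U) \<subseteq> V"
    using assms by (intro vec.span_minimal) auto
  moreover have "vec.dim (insert x U) = Suc (vec.dim U)"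
    using assms by (simp add: vec.dim_insert vec.span_eq_iff[THEN iffD2])
  ultimately show ?thesis
    using vec.span_superset[of "insert x U"] by (auto simp: subspaces_between_def)
qed

lemma between_eq_span_insert:
  assumes "vec.subspace U" "W \<in> subspaces_between U V (Suc (vec.dim U))" "x \<in> W - U"
  shows "W = vec.span (insert x U)"
proof -
  have W: "vec.subspace W" "U \<subseteq> W" "vec.dim W = Suc (vec.dim U)"
    using assms(2) by (auto simp: subspaces_between_def)
  then have "vec.span (insert x U) \<in> subspaces_between U W (Suc (vec.dim U))"
    using assms by (intro span_insert_between) auto
  then show ?thesis
    using W vec.subspace_dim_equal[of "vec.span (insert x U)" W]
    by (simp add: subspaces_between_def)
qed

text \<open>The sets \<open>W - U\<close> partition \<open>V - U\<close> into classes of equal size,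
  because \<open>W\<close> is recovered as the span of \<open>U\<close> and any one vector of
  \<open>W - U\<close>. The quotient of the two cardinalities is a geometric sum.\<close>

lemma card_subspaces_between_Suc:
  fixes U V :: "('a::{field,finite} ^ 'n) set"
  assumes U: "vec.subspace U" and V: "vec.subspace V" and UV: "U \<subseteq> V"
  shows "card (subspaces_between U V (Suc (vec.dim U))) = (\<Sum>i<vec.dim V - vec.dim U. CARD('a) ^ i)"
proof -
  define q k n where "q = CARD('a)" and "k = vec.dim U" and "n = vec.dim V"
  define F where "F = subspaces_between U V (Suc k)"
  have kn: "k \<le> n" unfolding k_def n_def using UV by (rule vec.dim_subset)
  have q: "q > 1"
    unfolding q_def using card_mono[of UNIV "{0, 1 :: 'a}"] by simp
  have F: "vec.subspace W" "U \<subseteq> W" "W \<subseteq> V" "vec.dim W = Suc k" if "W \<in> F" for W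
    using that by (auto simp: F_def subspaces_between_def)
  have uniq: "W = vec.span (insert x U)" if "W \<in> F" "x \<in> W - U" for W x
    using between_eq_span_insert[OF U] that by (simp add: F_def k_def)
  have "V - U = (\<Union>W\<in>F. W - U)"
  proof (intro equalityI subsetI)
    fix x assume x: "x \<in> V - U"
    have "vec.span (insert x U) \<in> F"
      unfolding F_def k_def by (rule span_insert_between[OF U V UV x])
    moreover have "x \<in> vec.span (insert x U)" by (simp add: vec.span_base)
    ultimately show "x \<in> (\<Union>W\<in>F. W - U)" using x by blast
  qed (use F in blast)
  moreover have "(W - U) \<inter> (W' - U) = {}" if "W \<in> F" "W' \<in> F" "W \<noteq> W'" for W W'
    using uniq[OF that(1)] uniq[OF that(2)] that(3) by (metis IntE equals0I)
  ultimately have "card (V - U) = (\<Sum>W\<in>F. card (W - U))"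
    by (simp only:) (rule card_UN_disjoint, auto)
  also have "\<dots> = (\<Sum>W\<in>F. q ^ Suc k - q ^ k)"
    using F U by (intro sum.cong refl)
      (simp add: card_Diff_subset card_subspace q_def k_def)
  finally have "card F * (q ^ Suc k - q ^ k) = q ^ n - q ^ k"
    using U V UV by (simp add: card_Diff_subset card_subspace q_def k_def n_def)
  also have "q ^ n - q ^ k = q ^ k * (q ^ (n - k) - 1)"
    using kn by (simp add: diff_mult_distrib2 flip: power_add)
  also have "q ^ (n - k) - 1 = (q - 1) * (\<Sum>i<n - k. q ^ i)"
  proof -
    have "int (q ^ (n - k) - 1) = int ((q - 1) * (\<Sum>i<n - k. q ^ i))"
      using q power_diff_1_eq[of "int q" "n - k"] by (simp add: of_nat_diff)
    then show ?thesis by linarith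
  qed
  also have "q ^ k * ((q - 1) * (\<Sum>i<n - k. q ^ i)) = (\<Sum>i<n - k. q ^ i) * (q ^ Suc k - q ^ k)"
    by (simp add: algebra_simps diff_mult_distrib2)
  finally have "card F * (q ^ Suc k - q ^ k) = (\<Sum>i<n - k. q ^ i) * (q ^ Suc k - q ^ k)" .
  moreover have "q ^ Suc k - q ^ k > 0" using q by simp
  ultimately show ?thesis by (simp add: F_def q_def k_def n_def)
qed

text \<open>Double count of the flags \<open>U \<subseteq> W \<subseteq> Y \<subseteq> V\<close>
  with \<open>W\<close> one dimension above \<open>U\<close> and \<open>dim Y = m\<close>. It
  reduces a count above \<open>U\<close> to the counts above the larger \<open>W\<close>.\<close>

lemma card_subspaces_between_step:
  fixes U V :: "('a::{field,finite} ^ 'n) set"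
  assumes U: "vec.subspace U" and V: "vec.subspace V" and UV: "U \<subseteq> V" and m: "m > vec.dim U"
    and g: "\<And>W. W \<in> subspaces_between U V (Suc (vec.dim U)) \<Longrightarrow> card (subspaces_between W V m) = g"
  shows "card (subspaces_between U V m) * (\<Sum>i<m - vec.dim U. CARD('a) ^ i) =
    (\<Sum>i<vec.dim V - vec.dim U. CARD('a) ^ i) * g"
proof -
  let ?A = "subspaces_between U V (Suc (vec.dim U))" and ?B = "subspaces_between U V m"
  have "(\<Sum>i<vec.dim V - vec.dim U. CARD('a) ^ i) * g = (\<Sum>W\<in>?A. card (subspaces_between W V m))"
    using g by (simp add: card_subspaces_between_Suc[OF U V UV])
  also have "\<dots> = (\<Sum>W\<in>?A. card {Y \<in> ?B. W \<subseteq> Y})"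
    by (intro sum.cong refl arg_cong[of _ _ card]) (auto simp: subspaces_between_def)
  also have "\<dots> = (\<Sum>Y\<in>?B. card {W \<in> ?A. W \<subseteq> Y})"
    by (intro sum_multicount_gen) auto
  also have "\<dots> = (\<Sum>Y\<in>?B. card (subspaces_between U Y (Suc (vec.dim U))))"
    by (intro sum.cong refl arg_cong[of _ _ card]) (auto simp: subspaces_between_def)
  also have "\<dots> = (\<Sum>Y\<in>?B. (\<Sum>i<m - vec.dim U. CARD('a) ^ i))"
    by (intro sum.cong refl) (simp add: subspaces_between_def[of U V m] U card_subspaces_between_Suc)
  finally show ?thesis by simp
qed

lemma subspaces_between_self:
  assumes "vec.subspace U" "U \<subseteq> V"
  shows "subspaces_between U V (vec.dim U) = {U}"
proof (intro equalityI subsetI)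
  fix W assume "W \<in> subspaces_between U V (vec.dim U)"
  then have "vec.subspace W" "vec.dim W = vec.dim U" "U \<subseteq> W"
    by (auto simp: subspaces_between_def)
  with assms(1) vec.subspace_dim_equal[of U W] show "W \<in> {U}" by simp
qed (use assms in \<open>simp add: subspaces_between_def\<close>)

text \<open>A quotient space has as many hyperplanes as points. Rather than through the dual space,
  this is reached by induction on the codimension of \<open>U\<close>.\<close>

lemma card_hyperplanes_between:
  fixes U V :: "('a::{field,finite} ^ 'n) set"
  assumes "vec.subspace U" and V: "vec.subspace V" and "U \<subseteq> V" and "vec.dim U < vec.dim V"
  shows "card (subspaces_between U V (vec.dim V - 1)) = (\<Sum>i<vec.dim V - vec.dim U. CARD('a) ^ i)"
  using assms(1,3,4)
proof (induction "vec.dim V - vec.dim U" arbitrary: U rule: less_induct)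
  case less
  define q :: nat where "q = CARD('a)"
  show ?case
  proof (cases "vec.dim V = Suc (vec.dim U)")
    case True
    then show ?thesis
      using subspaces_between_self[OF less.prems(1,2)] by simp
  next
    case False
    define m where "m = vec.dim V - Suc (vec.dim U)"
    have "m > 0" using False less.prems(3) by (simp add: m_def)
    have "card (subspaces_between W V (vec.dim V - 1)) = (\<Sum>i<m. CARD('a) ^ i)"
      if "W \<in> subspaces_between U V (Suc (vec.dim U))" for W
      using that less.hyps[of W] less.prems False by (simp add: subspaces_between_def m_def)
    \<comment> \<open>The left factor, points of a hyperplane of \<open>V / U\<close>, and the
      inductive count, hyperplanes above \<open>W\<close>, are the same geometric sum and
      cancel.\<close>
    then have "card (subspaces_between U V (vec.dim V - 1)) * (\<Sum>i<vec.dim V - 1 - vec.dim U. CARD('a) ^ i) =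
        (\<Sum>i<vec.dim V - vec.dim U. CARD('a) ^ i) * (\<Sum>i<m. CARD('a) ^ i)"
      using less.prems V False by (intro card_subspaces_between_step) auto
    moreover have "vec.dim V - 1 - vec.dim U = m"
      by (simp add: m_def)
    moreover have "(\<Sum>i<m. CARD('a) ^ i) > 0"
      using \<open>m > 0\<close> by (intro sum_pos) (auto simp: finite_UNIV_card_ge_0)
    ultimately show ?thesis by (metis mult_cancel2 less_irrefl)
  qed
qed

text \<open>The binomial coefficient counts the \<open>k\<close>-subsets of \<open>C\<close>
  incident with \<open>b\<close>; after exchanging the sums every \<open>k\<close>-subset
  contributes \<open>m\<close>. This is the \<open>k\<close>-th binomial moment of the incidence
  number.\<close>

lemma sum_choose_incidences:
  assumes "finite B" "finite C"
    and "\<And>S. S \<subseteq> C \<Longrightarrow> card S = k \<Longrightarrow> card {b \<in> B. \<forall>p\<in>S. R p b} = m"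
  shows "(\<Sum>b\<in>B. card {p \<in> C. R p b} choose k) = (card C choose k) * m"
proof -
  let ?K = "{S. S \<subseteq> C \<and> card S = k}"
  have "card {p \<in> C. R p b} choose k = card {S \<in> ?K. \<forall>p\<in>S. R p b}" for b
  proof -
    have "{S \<in> ?K. \<forall>p\<in>S. R p b} = {S. S \<subseteq> {p \<in> C. R p b} \<and> card S = k}" by auto
    then show ?thesis using assms(2) by (simp add: n_subsets)
  qed
  then have "(\<Sum>b\<in>B. card {p \<in> C. R p b} choose k) = (\<Sum>b\<in>B. card {S \<in> ?K. \<forall>p\<in>S. R p b})"
    by simp
  also have "\<dots> = (\<Sum>S\<in>?K. card {b \<in> B. \<forall>p\<in>S. R p b})"
    using assms by (intro sum_multicount_gen) auto
  also have "\<dots> = (\<Sum>S\<in>?K. m)"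
    using assms(3) by (intro sum.cong) auto
  finally show ?thesis using assms(2) by (simp add: n_subsets)
qed

lemma choose_2_real: "real (n choose 2) = real n * (real n - 1) / 2"
  by (induction n) (auto simp: numeral_2_eq_2 field_simps)

lemma choose_3_real: "real (n choose 3) = real n * (real n - 1) * (real n - 2) / 6"
proof (induction n)
  case (Suc n)
  have "Suc n choose 3 = (n choose 2) + (n choose 3)"
    by (simp add: numeral_3_eq_3 numeral_2_eq_2)
  then show ?case using Suc by (simp add: choose_2_real field_simps)
qed simp

lemma card_filter_real: "finite A \<Longrightarrow> real (card {x \<in> A. P x}) = (\<Sum>x\<in>A. if P x then 1 else 0)"
  by (simp add: sum.If_cases Int_def)

lemma meets_subspace_iff:
  fixes l A :: "('a::field ^ 'n) set"
  assumes "vec.subspace l" "vec.subspace A"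
  shows "(\<exists>p. vec.subspace p \<and> vec.dim p = 1 \<and> p \<subseteq> l \<and> p \<subseteq> A) \<longleftrightarrow> vec.dim (l \<inter> A) > 0"
proof
  assume "\<exists>p. vec.subspace p \<and> vec.dim p = 1 \<and> p \<subseteq> l \<and> p \<subseteq> A"
  then obtain p where "vec.dim p = 1" "p \<subseteq> l \<inter> A" by blast
  then show "vec.dim (l \<inter> A) > 0" using vec.dim_subset[of p "l \<inter> A"] by simp
next
  assume "vec.dim (l \<inter> A) > 0"
  then have "\<not> l \<inter> A \<subseteq> {0}" using vec.dim_eq_0[of "l \<inter> A"] by linarith
  then obtain x where x: "x \<in> l" "x \<in> A" "x \<noteq> 0" by blast
  then have "vec.span {x} \<subseteq> l" "vec.span {x} \<subseteq> A"
    using assms by (simp_all add: vec.span_minimal)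
  then show "\<exists>p. vec.subspace p \<and> vec.dim p = 1 \<and> p \<subseteq> l \<and> p \<subseteq> A"
    using x by (intro exI[of _ "vec.span {x}"]) simp
qed

text \<open>The join of two subspaces, written as a set of sums to match the dimension formula
  \<open>vec.dim_sums_Int\<close>.\<close>

definition subspace_sum :: "('a::field ^ 'n) set \<Rightarrow> ('a ^ 'n) set \<Rightarrow> ('a ^ 'n) set" where
  "subspace_sum S T = {x + y |x y. x \<in> S \<and> y \<in> T}"

lemma subspace_sum:
  assumes "vec.subspace S" "vec.subspace T"
  shows "vec.subspace (subspace_sum S T)" "S \<subseteq> subspace_sum S T" "T \<subseteq> subspace_sum S T"
    and "vec.subspace W \<Longrightarrow> subspace_sum S T \<subseteq> W \<longleftrightarrow> S \<subseteq> W \<and> T \<subseteq> W"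
    and "vec.dim (subspace_sum S T) + vec.dim (S \<inter> T) = vec.dim S + vec.dim T"
proof -
  have eq: "subspace_sum S T = vec.span (S \<union> T)"
    using assms by (simp add: subspace_sum_def vec.span_Un vec.span_eq_iff[THEN iffD2])
  show "vec.subspace (subspace_sum S T)" by (simp add: eq)
  show "S \<subseteq> subspace_sum S T" "T \<subseteq> subspace_sum S T"
    unfolding eq using vec.span_superset[of "S \<union> T"] by auto
  show "subspace_sum S T \<subseteq> W \<longleftrightarrow> S \<subseteq> W \<and> T \<subseteq> W" if "vec.subspace W"
    unfolding eq using that vec.span_minimal[of "S \<union> T" W] vec.span_superset[of "S \<union> T"] by auto
  show "vec.dim (subspace_sum S T) + vec.dim (S \<inter> T) = vec.dim S + vec.dim T"
    unfolding subspace_sum_def by (rule vec.dim_sums_Int[OF assms])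
qed

text \<open>Counting incident pairs from the side of the planes: only the number of lines per plane
  has to be constant, not the number of planes per line.\<close>

lemma avg_planes_through_eq:
  fixes ps ls :: "('a::{field,finite} ^ 4) set set"
  assumes "\<And>\<pi>. \<pi> \<in> ps \<Longrightarrow> real (lines_in ls \<pi>) = c"
  shows "avg_planes_through ps ls = real (card ps) * c / real (card ls)"
proof -
  have "(\<Sum>l\<in>ls. planes_through ps l) = (\<Sum>\<pi>\<in>ps. lines_in ls \<pi>)"
    unfolding planes_through_def lines_in_def by (intro sum_multicount_gen) auto
  then have "(\<Sum>l\<in>ls. real (planes_through ps l)) = (\<Sum>\<pi>\<in>ps. real (lines_in ls \<pi>))"
    by (metis of_nat_sum)
  with assms show ?thesis by (simp add: avg_planes_through_def)
qed

section \<open>Points of the twisted cubic in subspaces\<close>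

lemma subspace_proj_plane [simp]: "vec.subspace (proj_plane c0 c1 c2 c3 :: ('a::field ^ 4) set)"
proof -
  have "c0 * (x $ 1 + y $ 1) + c1 * (x $ 2 + y $ 2) + c2 * (x $ 3 + y $ 3) + c3 * (x $ 4 + y $ 4) = 0"
    if "c0 * x $ 1 + c1 * x $ 2 + c2 * x $ 3 + c3 * x $ 4 = 0"
      "c0 * y $ 1 + c1 * y $ 2 + c2 * y $ 3 + c3 * y $ 4 = 0" for x y :: "'a ^ 4"
    using arg_cong2[OF that, of "(+)"] by (simp add: algebra_simps)
  moreover have "c0 * (k * x $ 1) + c1 * (k * x $ 2) + c2 * (k * x $ 3) + c3 * (k * x $ 4) = 0"
    if "c0 * x $ 1 + c1 * x $ 2 + c2 * x $ 3 + c3 * x $ 4 = 0" for x :: "'a ^ 4" and k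
    using arg_cong[OF that, of "(*) k"] by (simp add: algebra_simps)
  ultimately show ?thesis
    by (simp add: vec.subspace_def proj_plane_def)
qed

lemma dim_UNIV_4: "vec.dim (UNIV :: ('a::field ^ 4) set) = 4"
  by (simp add: vec.dim_UNIV card_cart_basis)

lemma proj_plane_in_proj_planes:
  assumes "c0 \<noteq> 0 \<or> c1 \<noteq> 0 \<or> c2 \<noteq> 0 \<or> c3 \<noteq> 0"
  shows "(proj_plane c0 c1 c2 c3 :: ('a::field ^ 4) set) \<in> proj_planes"
proof -
  let ?K = "proj_plane c0 c1 c2 c3"
  let ?f = "\<lambda>x :: 'a ^ 4. c0 * x $ 1 + c1 * x $ 2 + c2 * x $ 3 + c3 * x $ 4"
  obtain x where x: "?f x \<noteq> 0"
    using assms vector_4 by (metis add_0 add.right_neutral mult.right_neutral mult_zero_right)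
  have "v \<in> vec.span (insert x ?K)" for v
  proof -
    have "?f (v - k *s x) = ?f v - k * ?f x" for k
      by (simp add: algebra_simps)
    from this[of "?f v / ?f x"] have "?f (v - (?f v / ?f x) *s x) = 0"
      using x by simp
    then have "v - (?f v / ?f x) *s x \<in> ?K"
      by (simp only: proj_plane_def mem_Collect_eq)
    then show ?thesis
      unfolding vec.span_insert using vec.span_base by blast
  qed
  then have "vec.dim (UNIV :: ('a ^ 4) set) \<le> vec.dim (insert x ?K)"
    by (intro vec.dim_mono) auto
  then have "3 \<le> vec.dim ?K"
    using vec.dim_insert[of x ?K] dim_UNIV_4[where 'a = 'a] by (simp split: if_splits)
  moreover have "?K \<subset> UNIV"
    using x by (auto simp: proj_plane_def)
  then have "vec.dim ?K < 4"
    using vec.dim_psubset[of ?K UNIV] dim_UNIV_4[where 'a = 'a]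
    by (simp add: vec.span_eq_iff[THEN iffD2])
  ultimately show ?thesis
    by (simp add: proj_planes_def)
qed

lemma proj_planes_cases:
  fixes \<pi> :: "('a::field ^ 4) set"
  assumes "\<pi> \<in> proj_planes"
  obtains c0 c1 c2 c3 where "\<pi> = proj_plane c0 c1 c2 c3"
    and "c0 \<noteq> 0 \<or> c1 \<noteq> 0 \<or> c2 \<noteq> 0 \<or> c3 \<noteq> 0"
proof -
  have \<pi>: "vec.subspace \<pi>" "vec.dim \<pi> = 3" using assms by (auto simp: proj_planes_def)
  obtain B where B: "B \<subseteq> \<pi>" "vec.independent B" "\<pi> \<subseteq> vec.span B" "card B = vec.dim \<pi>"
    using vec.basis_exists by blast
  have span: "vec.span B = \<pi>"
    using B \<pi> by (metis vec.span_eq_iff vec.span_mono subset_antisym)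
  have "\<pi> \<noteq> UNIV" using \<pi>(2) dim_UNIV_4[where 'a = 'a] by force
  then obtain x where x: "x \<notin> \<pi>" by blast
  then have "vec.independent (insert x B)"
    using B span by (simp add: vec.independent_insert)
  from vec.linear_independent_extend[OF this, of "\<lambda>y. if y = x then x else 0"]
  obtain f where f: "Vector_Spaces.linear (*s) (*s) f"
    "f x = x" "\<And>y. y \<in> B \<Longrightarrow> f y = 0"
    using B x by (metis (mono_tags, lifting) insertCI subsetD)
  have f0: "f y = 0" if "y \<in> \<pi>" for y
    using vec.linear_eq_0_on_span[OF f(1), of B y] that span f(3) by blast
  have "x \<noteq> 0" using x \<pi> vec.subspace_0 by metis
  \<comment> \<open>The \<open>i\<close>-th coordinate of \<open>f\<close> is a functional that
    kills \<pi> but not \<open>x\<close>; row \<open>i\<close> of the matrix of \<open>f\<close>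
    holds the coefficients of the plane, and equality follows by dimension.\<close>
  then obtain i where i: "x $ i \<noteq> 0" by (metis vec_eq_iff zero_index)
  define A where "A = matrix f"
  have A: "f y $ i = A $ i $ 1 * y $ 1 + A $ i $ 2 * y $ 2 + A $ i $ 3 * y $ 3 + A $ i $ 4 * y $ 4" for y
    using matrix_works[OF f(1), of y] by (simp add: A_def matrix_vector_mult_def sum_4 vec_eq_iff)
  let ?K = "proj_plane (A $ i $ 1) (A $ i $ 2) (A $ i $ 3) (A $ i $ 4)"
  have nz: "A $ i $ 1 \<noteq> 0 \<or> A $ i $ 2 \<noteq> 0 \<or> A $ i $ 3 \<noteq> 0 \<or> A $ i $ 4 \<noteq> 0"
    using A[of x] i f(2) by auto
  have "\<pi> \<subseteq> ?K" using f0 by (auto simp: proj_plane_def A[symmetric])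
  then have "\<pi> = ?K"
    using proj_plane_in_proj_planes[OF nz] \<pi>
    by (intro vec.subspace_dim_equal) (auto simp: proj_planes_def)
  then show ?thesis using nz that by blast
qed

lemma proj_point_subset_iff:
  assumes "vec.subspace V"
  shows "proj_point a b c d \<subseteq> V \<longleftrightarrow> vector [a, b, c, d] \<in> V"
  using assms vec.span_base[of "vector [a, b, c, d]" "{vector [a, b, c, d]}"]
    vec.span_minimal[of "{vector [a, b, c, d]}" V]
  by (auto simp: proj_point_def)

lemma proj_point_subset_proj_plane_iff:
  "proj_point a b c d \<subseteq> proj_plane c0 c1 c2 c3 \<longleftrightarrow> c0 * a + c1 * b + c2 * c + c3 * d = 0"
  by (simp add: proj_point_subset_iff) (simp add: proj_plane_def)

lemma twisted_cubic_subset_proj_points: "twisted_cubic \<subseteq> proj_points"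
proof -
  have "(vector [t ^ 3, t\<^sup>2, t, 1] :: 'a::field ^ 4) \<noteq> 0" "(vector [1, 0, 0, 0] :: 'a ^ 4) \<noteq> 0" for t
    by (auto simp: vec_eq_iff forall_4)
  then show ?thesis
    by (auto simp: twisted_cubic_def proj_points_def proj_point_def)
qed

section \<open>Parametrisation of the cubic and its points in planes and subspaces\<close>

definition cubic_pt :: "'a::field \<Rightarrow> ('a ^ 4) set" where
  "cubic_pt t = proj_point (t ^ 3) (t\<^sup>2) t 1"

lemma inj_cubic_pt: "inj cubic_pt"
proof
  fix t u :: 'a assume "cubic_pt t = cubic_pt u"
  \<comment> \<open>The plane \<open>x2 = u x3\<close> separates the affine points: it contains the
    one with parameter \<open>t\<close> only for \<open>t = u\<close>.\<close>
  then have "cubic_pt t \<subseteq> proj_plane 0 0 1 (- u) \<longleftrightarrow> cubic_pt u \<subseteq> proj_plane 0 0 1 (- u)" by simp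
  then show "t = u" by (simp add: cubic_pt_def proj_point_subset_proj_plane_iff)
qed

lemma infinity_notin_range_cubic_pt: "(proj_point 1 0 0 0 :: ('a::field ^ 4) set) \<notin> range cubic_pt"
proof
  assume "(proj_point 1 0 0 0 :: ('a ^ 4) set) \<in> range cubic_pt"
  then obtain t :: 'a where "cubic_pt t = proj_point 1 0 0 0" by (metis imageE)
  moreover have "proj_point 1 0 0 0 \<subseteq> (proj_plane 0 0 0 1 :: ('a ^ 4) set)"
    by (simp add: proj_point_subset_proj_plane_iff)
  ultimately have "cubic_pt t \<subseteq> proj_plane 0 0 0 1" by simp
  then show False by (simp add: cubic_pt_def proj_point_subset_proj_plane_iff)
qed

lemma twisted_cubic_eq: "twisted_cubic = insert (proj_point 1 0 0 0) (range cubic_pt)"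
  by (simp add: twisted_cubic_def cubic_pt_def)

lemma card_twisted_cubic: "card (twisted_cubic :: ('a::{field,finite} ^ 4) set set) = CARD('a) + 1"
  using infinity_notin_range_cubic_pt[where 'a = 'a] card_image[OF inj_cubic_pt[where 'a = 'a]]
  by (simp add: twisted_cubic_eq)

text \<open>The cubic points in a plane are the distinct roots of its binary cubic form on the
  projective line; the first summand is the root at infinity.\<close>

lemma card_cubic_points_in_plane:
  fixes c0 c1 c2 c3 :: "'a::{field,finite}"
  shows "card {p \<in> twisted_cubic. p \<subseteq> proj_plane c0 c1 c2 c3} =
    (if c0 = 0 then 1 else 0) + card {t. c0 * t ^ 3 + c1 * t\<^sup>2 + c2 * t + c3 = 0}"
proof -
  let ?R = "{t. c0 * t ^ 3 + c1 * t\<^sup>2 + c2 * t + c3 = 0}"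
  have pts: "proj_point 1 0 0 0 \<subseteq> proj_plane c0 c1 c2 c3 \<longleftrightarrow> c0 = 0"
    "cubic_pt t \<subseteq> proj_plane c0 c1 c2 c3 \<longleftrightarrow> c0 * t ^ 3 + c1 * t\<^sup>2 + c2 * t + c3 = 0" for t
    by (simp_all add: proj_point_subset_proj_plane_iff cubic_pt_def)
  have "{p \<in> twisted_cubic. p \<subseteq> proj_plane c0 c1 c2 c3} =
      (if c0 = 0 then {proj_point 1 0 0 0} else {}) \<union> cubic_pt ` ?R"
    unfolding pts[symmetric] twisted_cubic_eq
  proof -
    have "{p \<in> insert a (range f). Q p} = (if Q a then {a} else {}) \<union> f ` {t. Q (f t)}"
      for a :: "('a ^ 4) set" and f :: "'a \<Rightarrow> _" and Q
      by auto
    then show "{p \<in> insert (proj_point 1 0 0 0) (range cubic_pt). p \<subseteq> proj_plane c0 c1 c2 c3} =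
        (if proj_point 1 0 0 0 \<subseteq> proj_plane c0 c1 c2 c3 then {proj_point 1 0 0 0} else {}) \<union>
        cubic_pt ` {t. cubic_pt t \<subseteq> proj_plane c0 c1 c2 c3}" .
  qed
  moreover have "(if c0 = 0 then {proj_point 1 0 0 0} else {}) \<inter> cubic_pt ` ?R = {}"
    using infinity_notin_range_cubic_pt[where 'a = 'a] by auto
  moreover have "card (cubic_pt ` ?R) = card ?R"
    using inj_cubic_pt by (intro card_image) (rule inj_on_subset, auto)
  ultimately show ?thesis
    by (simp add: card_Un_disjoint)
qed

lemma card_cubic_points_in_plane_le:
  fixes \<pi> :: "('a::{field,finite} ^ 4) set"
  assumes "\<pi> \<in> proj_planes"
  shows "card {p \<in> twisted_cubic. p \<subseteq> \<pi>} \<le> 3"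
proof -
  obtain c0 c1 c2 c3 where c: "\<pi> = proj_plane c0 c1 c2 c3"
    and nz: "c0 \<noteq> 0 \<or> c1 \<noteq> 0 \<or> c2 \<noteq> 0 \<or> c3 \<noteq> 0"
    using assms by (rule proj_planes_cases)
  let ?p = "[:c3, c2, c1, c0:]"
  have "{t. c0 * t ^ 3 + c1 * t\<^sup>2 + c2 * t + c3 = 0} = {t. poly ?p t = 0}"
    by (simp add: algebra_simps power2_eq_square power3_eq_cube)
  moreover have "card {t. poly ?p t = 0} \<le> Polynomial.degree ?p"
    using nz by (intro card_poly_roots_bound) auto
  \<comment> \<open>For \<open>c0 = 0\<close> the degree drops by one, which makes room for the
    point at infinity.\<close>
  moreover have "Polynomial.degree ?p \<le> (if c0 = 0 then 2 else 3)"
    by simp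
  ultimately show ?thesis
    unfolding c card_cubic_points_in_plane by (simp split: if_splits)
qed

lemma card_cubic_points_in_subspace_le:
  fixes V :: "('a::{field,finite} ^ 4) set"
  assumes "vec.subspace V" "vec.dim V \<le> 3" "CARD('a) \<ge> 3"
  shows "card {p \<in> twisted_cubic. p \<subseteq> V} \<le> vec.dim V"
  using assms(1,2)
proof (induction "3 - vec.dim V" arbitrary: V) \<comment> \<open>a counterexample of dimension below 3 would extend, by a further point, to one of larger dimension\<close>
  case 0
  then show ?case
    using card_cubic_points_in_plane_le[of V] by (simp add: proj_planes_def)
next
  case (Suc n)
  let ?D = "\<lambda>V. {p \<in> twisted_cubic. p \<subseteq> V}"
  have IH: "card (?D (vec.span (insert x V))) \<le> Suc (vec.dim V)" if "x \<notin> V" for x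
    using that Suc vec.dim_insert[of x V] Suc.hyps(1)[of "vec.span (insert x V)"]
    by (simp add: vec.span_eq_iff[THEN iffD2])
  show ?case
  proof (cases "?D V = twisted_cubic")
    \<comment> \<open>Here no further cubic point is available. An arbitrary extension then holds
      all of at least four points, while its dimension is at most 3.\<close>
    case True
    have "V \<noteq> UNIV" using Suc.prems(2) dim_UNIV_4[where 'a = 'a] by force
    then obtain x where x: "x \<notin> V" by blast
    have "V \<subseteq> vec.span (insert x V)"
      by (meson subset_insertI vec.span_superset subset_trans)
    then have "?D (vec.span (insert x V)) = twisted_cubic"
      using True by blast
    with IH[OF x] Suc.hyps(2) show ?thesis
      using assms(3) by (simp add: card_twisted_cubic)
  next
    case False
    then obtain p where p: "p \<in> twisted_cubic" "\<not> p \<subseteq> V" by blast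
    then have "p \<in> proj_points" using twisted_cubic_subset_proj_points by blast
    then have sp: "vec.subspace p" "vec.dim p = 1" by (auto simp: proj_points_def)
    obtain x where x: "x \<in> p" "x \<notin> V" using p by blast
    have "x \<noteq> 0" using x Suc.prems vec.subspace_0 by metis
    then have "p = vec.span {x}" by (intro point_eq_span sp x)
    then have "p \<subseteq> vec.span (insert x V)"
      by (simp add: vec.span_mono)
    moreover have "V \<subseteq> vec.span (insert x V)"
      by (meson subset_insertI vec.span_superset subset_trans)
    ultimately have "insert p (?D V) \<subseteq> ?D (vec.span (insert x V))"
      using p by blast
    then have "card (insert p (?D V)) \<le> card (?D (vec.span (insert x V)))"
      by (intro card_mono) auto
    with IH[OF x(2)] p show ?thesis by simp
  qed
qed

section \<open>Independence of at most three cubic points\<close>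

lemma dim_span_Union_le:
  fixes S :: "('a::{field,finite} ^ 'n) set set"
  assumes "finite S" "S \<subseteq> {p. vec.subspace p \<and> vec.dim p = 1}"
  shows "vec.dim (\<Union>S) \<le> card S"
proof -
  have "\<exists>x. p = vec.span {x}" if "p \<in> S" for p
  proof -
    from that assms have p: "vec.subspace p" "vec.dim p = 1" by auto
    obtain x where x: "x \<in> p" "x \<noteq> 0"
      using p by (metis subsetI singletonI vec.dim_eq_0 zero_neq_one)
    then show ?thesis using point_eq_span[OF p] by blast
  qed
  then obtain v where v: "\<And>p. p \<in> S \<Longrightarrow> p = vec.span {v p}" by metis
  have "\<Union>S \<subseteq> vec.span (v ` S)"
  proof
    fix y assume "y \<in> \<Union>S"
    then obtain p where "p \<in> S" "y \<in> p" by blast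
    with v have "y \<in> vec.span {v p}" by blast
    with \<open>p \<in> S\<close> show "y \<in> vec.span (v ` S)"
      using vec.span_mono[of "{v p}" "v ` S"] by blast
  qed
  then have "vec.dim (\<Union>S) \<le> card (v ` S)"
    using assms by (intro vec.dim_le_card) auto
  also have "\<dots> \<le> card S" by (rule card_image_le[OF assms(1)])
  finally show ?thesis .
qed

text \<open>If the span were too small, it would contain more cubic points than its dimension
  allows.\<close>

lemma dim_span_cubic_points:
  fixes S :: "('a::{field,finite} ^ 4) set set"
  assumes "S \<subseteq> twisted_cubic" "card S \<le> 3" "CARD('a) \<ge> 3"
  shows "vec.dim (vec.span (\<Union>S)) = card S"
proof (rule antisym)
  show le: "vec.dim (vec.span (\<Union>S)) \<le> card S"
    using assms twisted_cubic_subset_proj_points dim_span_Union_le[of S]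
    by (auto simp: proj_points_def)
  have "S \<subseteq> {p \<in> twisted_cubic. p \<subseteq> vec.span (\<Union>S)}"
    using assms(1) vec.span_superset[of "\<Union>S"] by blast
  then have "card S \<le> card {p \<in> twisted_cubic. p \<subseteq> vec.span (\<Union>S)}"
    by (intro card_mono) auto
  also have "\<dots> \<le> vec.dim (vec.span (\<Union>S))"
    using le assms by (intro card_cubic_points_in_subspace_le) auto
  finally show "card S \<le> vec.dim (vec.span (\<Union>S))" .
qed

definition cubic_number :: "('a::field ^ 4) set \<Rightarrow> nat" where
  "cubic_number V = card {p \<in> twisted_cubic. p \<subseteq> V}"

lemma span_Union_subset_iff:
  assumes "vec.subspace b"
  shows "vec.span (\<Union>S) \<subseteq> b \<longleftrightarrow> (\<forall>p\<in>S. p \<subseteq> b)"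
  using assms vec.span_minimal[of "\<Union>S" b] vec.span_superset[of "\<Union>S"] by blast

text \<open>Any \<open>k \<le> 3\<close> cubic points span a subspace of dimension \<open>k\<close>,
  so the number of \<open>W\<close> containing them is the same for every choice. It serves for
  planes of the whole space (\<open>m = 3\<close>) as well as for lines
  (\<open>m = 2\<close>).\<close>

lemma sum_choose_cubic_number:
  fixes V :: "('a::{field,finite} ^ 4) set"
  assumes "vec.subspace V" "CARD('a) \<ge> 3" "k \<le> 3"
    and c: "\<And>U. vec.subspace U \<Longrightarrow> U \<subseteq> V \<Longrightarrow> vec.dim U = k \<Longrightarrow> card (subspaces_between U V m) = c"
  shows "(\<Sum>W\<in>subspaces_between {0} V m. cubic_number W choose k) = (cubic_number V choose k) * c"
proof -
  let ?B = "subspaces_between {0} V m" and ?D = "{p \<in> twisted_cubic. p \<subseteq> V}"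
  have "(\<Sum>W\<in>?B. card {p \<in> ?D. p \<subseteq> W} choose k) = (card ?D choose k) * c"
  proof (rule sum_choose_incidences)
    fix S assume S: "S \<subseteq> ?D" "card S = k"
    have "{b \<in> ?B. \<forall>p\<in>S. p \<subseteq> b} = subspaces_between (vec.span (\<Union>S)) V m"
    proof (rule Set.set_eqI)
      fix b
      show "b \<in> {b \<in> ?B. \<forall>p\<in>S. p \<subseteq> b} \<longleftrightarrow> b \<in> subspaces_between (vec.span (\<Union>S)) V m"
        using span_Union_subset_iff[of b S] vec.subspace_0[of b]
        by (cases "vec.subspace b") (simp_all add: subspaces_between_def conj_ac)
    qed
    moreover have "card (subspaces_between (vec.span (\<Union>S)) V m) = c"
      using S assms dim_span_cubic_points[of S]
      by (intro c) (auto simp: span_Union_subset_iff simp del: subset_iff)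
    ultimately show "card {b \<in> ?B. \<forall>p\<in>S. p \<subseteq> b} = c" by simp
  qed auto
  moreover have "{p \<in> ?D. p \<subseteq> W} = {p \<in> twisted_cubic. p \<subseteq> W}" if "W \<in> ?B" for W
    using that by (auto simp: subspaces_between_def)
  ultimately show ?thesis by (simp add: cubic_number_def)
qed

lemma subspaces_between_0: "subspaces_between {0} V m = {W. vec.subspace W \<and> vec.dim W = m \<and> W \<subseteq> V}"
  by (auto simp: subspaces_between_def vec.subspace_0)

lemma proj_planes_eq: "proj_planes = subspaces_between {0} UNIV 3"
  by (auto simp: proj_planes_def subspaces_between_0)

lemma proj_lines_in_eq: "{l \<in> proj_lines. l \<subseteq> V} = subspaces_between {0} V 2"
  by (auto simp: proj_lines_def subspaces_between_0)

lemma external_lines_eq: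
  "external_lines = {l \<in> proj_lines. cubic_number (l :: ('a::{field,finite} ^ 4) set) = 0}"
  by (auto simp: external_lines_def cubic_number_def)

section \<open>Osculating planes and imaginary chords in characteristic 3\<close>

text \<open>Translation by 1 permutes the field, so the sum of all elements does not change when
  \<open>CARD('a)\<close> is added to it. Hence a power of 3 vanishes.\<close>

lemma three_eq_0:
  assumes "CARD('a::{field,finite}) = 3 ^ h"
  shows "(3 :: 'a) = 0"
proof -
  have "(\<Sum>x\<in>UNIV. x + 1 :: 'a) = \<Sum>UNIV"
    by (rule sum.reindex_bij_witness[of _ "\<lambda>x. x - 1" "\<lambda>x. x + 1"]) auto
  then have "of_nat CARD('a) = (0 :: 'a)"
    by (simp add: sum.distrib)
  with assms show ?thesis by simp
qed

lemma cube_diff: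
  fixes a b :: "'a::comm_ring_1"
  assumes "(3 :: 'a) = 0"
  shows "a ^ 3 - b ^ 3 = (a - b) ^ 3"
proof -
  have "(a - b) ^ 3 = a ^ 3 - b ^ 3 - 3 * (a * a * b - a * b * b)"
    by (simp add: algebra_simps power3_eq_cube)
  with assms show ?thesis by simp
qed

lemma cube_eq_iff:
  fixes a b :: "'a::idom"
  assumes "(3 :: 'a) = 0"
  shows "a ^ 3 = b ^ 3 \<longleftrightarrow> a = b"
  using cube_diff[OF assms, of a b] by auto

lemma surj_cube:
  assumes "(3 :: 'a::{field,finite}) = 0"
  shows "surj (\<lambda>t :: 'a. t ^ 3)"
  by (rule finite_UNIV_inj_surj) (auto simp: inj_on_def cube_eq_iff[OF assms])

lemma Gamma_planes_char_3:
  assumes "(3 :: 'a::field) = 0"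
  shows "(Gamma_planes :: ('a ^ 4) set set) =
    insert (proj_plane 0 0 0 1) (range (\<lambda>t. proj_plane 1 0 0 (- (t ^ 3))))"
  using assms by (simp add: Gamma_planes_def)

lemma Gamma_axis_char_3:
  assumes "(3 :: 'a::field) = 0"
  shows "Gamma_axis = {x :: 'a ^ 4. x $ 1 = 0 \<and> x $ 4 = 0}"
  by (auto simp: Gamma_axis_def Gamma_planes_char_3[OF assms] proj_plane_def dest: spec[of _ 0])

text \<open>Over a finite field the cardinality determines the dimension, so the bijection may be
  any map; linearity is not asked of it.\<close>

lemma dim_eq_2I:
  fixes V :: "('a::{field,finite} ^ 'n) set"
  assumes "vec.subspace V" and "bij_betw f V (UNIV :: ('a \<times> 'a) set)"
  shows "vec.dim V = 2"
proof -
  have "CARD('a) ^ vec.dim V = CARD('a) ^ 2"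
    using bij_betw_same_card[OF assms(2)] assms(1)
    by (simp add: card_subspace power2_eq_square card_prod)
  moreover have "CARD('a) > 1"
    using card_mono[of UNIV "{0, 1 :: 'a}"] by simp
  ultimately show ?thesis by (simp only: power_inject_exp)
qed

lemma Gamma_axis_in_proj_lines:
  assumes "(3 :: 'a::{field,finite}) = 0"
  shows "(Gamma_axis :: ('a ^ 4) set) \<in> proj_lines"
proof -
  have "vec.subspace (Gamma_axis :: ('a ^ 4) set)"
    by (simp add: Gamma_axis_char_3[OF assms] vec.subspace_def)
  moreover have "bij_betw (\<lambda>x. (x $ 2, x $ 3)) (Gamma_axis :: ('a ^ 4) set) UNIV"
    unfolding Gamma_axis_char_3[OF assms]
    by (rule bij_betw_byWitness[where f' = "\<lambda>(a, b). vector [0, a, b, 0]"])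
      (auto simp: vec_eq_iff forall_4)
  ultimately show ?thesis by (simp add: proj_lines_def dim_eq_2I)
qed

lemma Gamma_axis_subset_proj_plane_iff:
  assumes "(3 :: 'a::{field,finite}) = 0"
  shows "(Gamma_axis :: ('a ^ 4) set) \<subseteq> proj_plane c0 c1 c2 c3 \<longleftrightarrow> c1 = 0 \<and> c2 = 0"
proof
  assume *: "(Gamma_axis :: ('a ^ 4) set) \<subseteq> proj_plane c0 c1 c2 c3"
  have "(vector [0, 1, 0, 0] :: 'a ^ 4) \<in> Gamma_axis" "(vector [0, 0, 1, 0] :: 'a ^ 4) \<in> Gamma_axis"
    by (simp_all add: Gamma_axis_char_3[OF assms])
  with * have "(vector [0, 1, 0, 0] :: 'a ^ 4) \<in> proj_plane c0 c1 c2 c3"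
    "(vector [0, 0, 1, 0] :: 'a ^ 4) \<in> proj_plane c0 c1 c2 c3" by blast+
  then show "c1 = 0 \<and> c2 = 0" by (simp add: proj_plane_def)
qed (auto simp: Gamma_axis_char_3[OF assms] proj_plane_def)

lemma proj_plane_scale:
  assumes "k \<noteq> (0 :: 'a::field)"
  shows "proj_plane (k * c0) (k * c1) (k * c2) (k * c3) = proj_plane c0 c1 c2 c3"
proof -
  have "k * c0 * x $ 1 + k * c1 * x $ 2 + k * c2 * x $ 3 + k * c3 * x $ 4 =
      k * (c0 * x $ 1 + c1 * x $ 2 + c2 * x $ 3 + c3 * x $ 4)" for x :: "'a ^ 4"
    by (simp add: algebra_simps)
  then show ?thesis using assms by (simp add: proj_plane_def)
qed

text \<open>A plane through the axis has the form \<open>c0 x0 + c3 x3 = 0\<close>. Since every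
  field element is a cube, \<open>- c3 / c0\<close> is some \<open>t^3\<close>, which makes the
  plane osculating.\<close>

lemma Gamma_planes_eq:
  assumes "(3 :: 'a::{field,finite}) = 0"
  shows "(Gamma_planes :: ('a ^ 4) set set) = {\<pi> \<in> proj_planes. Gamma_axis \<subseteq> \<pi>}"
proof (intro equalityI subsetI)
  fix \<pi> :: "('a ^ 4) set" assume "\<pi> \<in> Gamma_planes"
  then consider "\<pi> = proj_plane 0 0 0 1" | t where "\<pi> = proj_plane 1 0 0 (- (t ^ 3))"
    by (auto simp: Gamma_planes_char_3[OF assms])
  then show "\<pi> \<in> {\<pi> \<in> proj_planes. Gamma_axis \<subseteq> \<pi>}"
    by cases (simp_all add: proj_plane_in_proj_planes Gamma_axis_subset_proj_plane_iff[OF assms])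
next
  fix \<pi> :: "('a ^ 4) set" assume "\<pi> \<in> {\<pi> \<in> proj_planes. Gamma_axis \<subseteq> \<pi>}"
  then have "\<pi> \<in> proj_planes" "Gamma_axis \<subseteq> \<pi>" by simp_all
  then obtain c0 c3 where \<pi>: "\<pi> = proj_plane c0 0 0 c3" and nz: "c0 \<noteq> 0 \<or> c3 \<noteq> 0"
    by (elim proj_planes_cases) (auto simp: Gamma_axis_subset_proj_plane_iff[OF assms])
  show "\<pi> \<in> Gamma_planes"
  proof (cases "c0 = 0")
    case True
    with nz have "\<pi> = proj_plane 0 0 0 1"
      using proj_plane_scale[of c3 0 0 0 1] by (simp add: \<pi>)
    then show ?thesis by (simp add: Gamma_planes_char_3[OF assms])
  next
    case False
    obtain t where "t ^ 3 = - c3 / c0"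
      using surjD[OF surj_cube[OF assms], of "- c3 / c0"] by auto
    then have "\<pi> = proj_plane 1 0 0 (- (t ^ 3))"
      using False proj_plane_scale[of c0 1 0 0 "c3 / c0"] by (simp add: \<pi>)
    then show ?thesis by (simp add: Gamma_planes_char_3[OF assms])
  qed
qed

lemma card_cubic_points_in_Gamma_plane:
  fixes \<pi> :: "('a::{field,finite} ^ 4) set"
  assumes "(3 :: 'a) = 0" and "\<pi> \<in> Gamma_planes"
  shows "card {p \<in> twisted_cubic. p \<subseteq> \<pi>} = 1"
  using assms(2)
  by (auto simp: Gamma_planes_char_3[OF assms(1)] card_cubic_points_in_plane cube_eq_iff[OF assms(1)])

text \<open>
  For \<open>T = s + s^q\<close> and \<open>N = s * s^q\<close> these are the linear recurrences satisfied by
  \<open>(s^3, s^2, s, 1)\<close> and its conjugate.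
\<close>

definition conj_line :: "'a::field \<Rightarrow> 'a \<Rightarrow> ('a ^ 4) set" where
  "conj_line T N = {v. v $ 1 - T * v $ 2 + N * v $ 3 = 0 \<and> v $ 2 - T * v $ 3 + N * v $ 4 = 0}"

section \<open>Lines given by a quadratic, and the planes through them\<close>

lemma conj_line_in_proj_lines: "conj_line (T :: 'a::{field,finite}) N \<in> proj_lines"
proof -
  have "conj_line T N = proj_plane 1 (- T) N 0 \<inter> proj_plane 0 1 (- T) N"
    by (auto simp: conj_line_def proj_plane_def)
  then have "vec.subspace (conj_line T N)"
    by (simp add: vec.subspace_inter)
  \<comment> \<open>The last two coordinates are free; the recurrences then yield the second and the
    first.\<close>
  moreover have "bij_betw (\<lambda>x. (x $ 3, x $ 4)) (conj_line T N) UNIV"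
    by (rule bij_betw_byWitness[where
          f' = "\<lambda>(a, b). vector [T * (T * a - N * b) - N * a, T * a - N * b, a, b]"])
      (auto simp: vec_eq_iff forall_4 conj_line_def, Groebner_Basis.algebra+)
  ultimately show ?thesis by (simp add: proj_lines_def dim_eq_2I)
qed

text \<open>The two equations say that the cubic form of the plane factors as
  \<open>(c0 t + (c1 + c0 T)) (t^2 - T t + N)\<close>.\<close>

lemma conj_line_subset_proj_plane_iff:
  "conj_line T N \<subseteq> proj_plane c0 c1 c2 c3 \<longleftrightarrow>
    c2 = c0 * N - (c1 + c0 * T) * T \<and> c3 = (c1 + c0 * T) * N"
proof
  assume *: "conj_line T N \<subseteq> proj_plane c0 c1 c2 c3"
  \<comment> \<open>The basis of the line whose last two coordinates are \<open>1, 0\<close> and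
    \<open>0, 1\<close>.\<close>
  have "vector [T * T - N, T, 1, 0] \<in> conj_line T N" "vector [- (T * N), - N, 0, 1] \<in> conj_line T N"
    by (simp_all add: conj_line_def)
  with * have "vector [T * T - N, T, 1, 0] \<in> proj_plane c0 c1 c2 c3"
    "vector [- (T * N), - N, 0, 1] \<in> proj_plane c0 c1 c2 c3" by blast+
  then have "c0 * (T * T - N) + c1 * T + c2 = 0" "c3 - c0 * (T * N) - c1 * N = 0"
    by (simp_all add: proj_plane_def algebra_simps)
  then show "c2 = c0 * N - (c1 + c0 * T) * T \<and> c3 = (c1 + c0 * T) * N"
    by Groebner_Basis.algebra \<comment> \<open>HOL-Algebra hides the unqualified method name\<close>
next
  assume c: "c2 = c0 * N - (c1 + c0 * T) * T \<and> c3 = (c1 + c0 * T) * N"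
  have "c0 * v1 + c1 * v2 + c2 * v3 + c3 * v4 = 0"
    if "v1 - T * v2 + N * v3 = 0" "v2 - T * v3 + N * v4 = 0" for v1 v2 v3 v4
    using c that by Groebner_Basis.algebra
  then show "conj_line T N \<subseteq> proj_plane c0 c1 c2 c3"
    by (auto simp: conj_line_def proj_plane_def)
qed

context
  fixes T N :: "'a::{field,finite}"
  assumes irreducible: "\<And>x. x\<^sup>2 - T * x + N \<noteq> 0"
begin

lemma conj_line_in_external_lines: "conj_line T N \<in> external_lines"
proof -
  have "vec.subspace (conj_line T N)"
    using conj_line_in_proj_lines by (auto simp: proj_lines_def)
  then have "\<not> p \<subseteq> conj_line T N" if "p \<in> twisted_cubic" for p
    using that irreducible
    by (auto simp: twisted_cubic_def proj_point_subset_iff conj_line_def)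
  then show ?thesis
    using conj_line_in_proj_lines by (auto simp: external_lines_def)
qed

text \<open>The quadratic factor has no root, so the only cubic point comes from the linear factor:
  \<open>- b / c0\<close>, or infinity when \<open>c0 = 0\<close>.\<close>

lemma plane_through_conj_line_in_one_bar_planes:
  assumes three: "(3 :: 'a) = 0" and \<pi>: "\<pi> \<in> proj_planes" "conj_line T N \<subseteq> \<pi>"
  shows "\<pi> \<in> one_bar_planes"
proof -
  obtain c0 c1 c2 c3 where c: "\<pi> = proj_plane c0 c1 c2 c3"
    and nz: "c0 \<noteq> 0 \<or> c1 \<noteq> 0 \<or> c2 \<noteq> 0 \<or> c3 \<noteq> 0"
    using \<pi>(1) by (rule proj_planes_cases)
  define b where "b = c1 + c0 * T"
  have b: "c1 = b - c0 * T" "c2 = c0 * N - b * T" "c3 = b * N"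
    using \<pi>(2) by (simp_all add: c conj_line_subset_proj_plane_iff b_def)
  have nz': "c0 \<noteq> 0 \<or> b \<noteq> 0" using nz b by auto
  have "c0 * t ^ 3 + c1 * t\<^sup>2 + c2 * t + c3 = (c0 * t + b) * (t\<^sup>2 - T * t + N)" for t
    unfolding b by (simp add: algebra_simps power2_eq_square power3_eq_cube)
  then have roots: "{t. c0 * t ^ 3 + c1 * t\<^sup>2 + c2 * t + c3 = 0} = {t. c0 * t + b = 0}"
    using irreducible by simp
  have "card {t. c0 * t + b = 0} = (if c0 = 0 then 0 else 1)"
  proof (cases "c0 = 0")
    case False
    then have "{t. c0 * t + b = 0} = {- b / c0}"
      by (auto simp: field_simps eq_neg_iff_add_eq_0)
    then show ?thesis using False by simp
  qed (use nz' in simp)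
  then have "card {p \<in> twisted_cubic. p \<subseteq> \<pi>} = 1"
    unfolding c card_cubic_points_in_plane roots by simp
  moreover have "\<pi> \<notin> Gamma_planes"
  proof
    assume "\<pi> \<in> Gamma_planes"
    then have c12: "c1 = 0" "c2 = 0"
      by (auto simp del: subset_iff simp: Gamma_planes_eq[OF three] c
        Gamma_axis_subset_proj_plane_iff[OF three])
    then have "c0 \<noteq> 0" using b nz' by auto
    moreover have "c0 * (N - T * T) = 0" using c12 b by Groebner_Basis.algebra
    ultimately have "N = T * T" by simp
    \<comment> \<open>In characteristic 3 the polynomial \<open>x^2 - T x + T^2\<close> is
      \<open>(x + T)^2\<close>, so \<open>- T\<close> would be a root.\<close>
    then have "(- T)\<^sup>2 - T * (- T) + N = 3 * (T * T)" by (simp add: power2_eq_square)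
    with three have "(- T)\<^sup>2 - T * (- T) + N = 0" by simp
    with irreducible show False by blast
  qed
  ultimately show ?thesis using \<pi>(1) by (simp add: one_bar_planes_def d_planes_def)
qed

end

text \<open>The single cubic point splits a linear factor off the cubic form, and the cofactor is
  the required quadratic. A root of the cofactor would be a second cubic point or make the form a
  cube, and the latter means that the plane is osculating.\<close>

lemma one_bar_plane_contains_conj_line:
  fixes \<pi> :: "('a::{field,finite} ^ 4) set"
  assumes three: "(3 :: 'a) = 0" and \<pi>: "\<pi> \<in> one_bar_planes"
  obtains T N where "\<And>x. x\<^sup>2 - T * x + N \<noteq> 0" "conj_line T N \<subseteq> \<pi>"
    "\<And>T' N'. (\<And>x. x\<^sup>2 - T' * x + N' \<noteq> 0) \<Longrightarrow> conj_line T' N' \<subseteq> \<pi> \<Longrightarrow> T' = T \<and> N' = N"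
proof -
  have "\<pi> \<in> proj_planes" using \<pi> by (simp add: one_bar_planes_def d_planes_def)
  then obtain c0 c1 c2 c3 where c: "\<pi> = proj_plane c0 c1 c2 c3"
    and nz: "c0 \<noteq> 0 \<or> c1 \<noteq> 0 \<or> c2 \<noteq> 0 \<or> c3 \<noteq> 0"
    by (rule proj_planes_cases)
  define f where "f t = c0 * t ^ 3 + c1 * t\<^sup>2 + c2 * t + c3" for t
  have card: "(if c0 = 0 then 1 else 0) + card {t. f t = 0} = 1"
    using \<pi> unfolding one_bar_planes_def d_planes_def c f_def
    by (simp flip: card_cubic_points_in_plane)
  have nG: "c1 \<noteq> 0 \<or> c2 \<noteq> 0"
    using \<pi> proj_plane_in_proj_planes[OF nz]
    by (auto simp del: subset_iff simp: one_bar_planes_def c Gamma_planes_eq[OF three]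
        Gamma_axis_subset_proj_plane_iff[OF three])
  show ?thesis
  proof (cases "c0 = 0")
    case True
    with card have nr: "f t \<noteq> 0" for t by auto
    have c1: "c1 \<noteq> 0"
    proof
      assume "c1 = 0"
      with nG True have "f (- c3 / c2) = 0" by (simp add: f_def)
      with nr show False by blast
    qed
    show ?thesis
    \<comment> \<open>The cubic point is at infinity; what remains is a rootless quadratic, made
      monic.\<close>
    proof (rule that[of "- c2 / c1" "c3 / c1"])
      fix x
      have "f x = c1 * (x\<^sup>2 - (- c2 / c1) * x + c3 / c1)"
        using True c1 by (simp add: f_def field_simps)
      with nr show "x\<^sup>2 - (- c2 / c1) * x + c3 / c1 \<noteq> 0" by (metis mult_zero_right)
    next
      show "conj_line (- c2 / c1) (c3 / c1) \<subseteq> \<pi>"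
        unfolding c conj_line_subset_proj_plane_iff using True c1 by simp
    next
      fix T N assume "conj_line T N \<subseteq> \<pi>"
      then have "c2 = - c1 * T" "c3 = c1 * N"
        unfolding c conj_line_subset_proj_plane_iff using True by simp_all
      then show "T = - c2 / c1 \<and> N = c3 / c1" using c1 by simp
    qed
  next
    case False
    with card obtain r where r: "{t. f t = 0} = {r}"
      by (auto simp: card_1_singleton_iff)
    then have fr: "f r = 0" by auto
    \<comment> \<open>The coefficients of the monic quotient of \<open>f\<close> by
      \<open>c0 (x - r)\<close>.\<close>
    define T N where "T = - (c1 + c0 * r) / c0" and "N = (c2 + c1 * r + c0 * r\<^sup>2) / c0"
    have TN: "c0 * T = - (c1 + c0 * r)" "c0 * N = c2 + c1 * r + c0 * r\<^sup>2"
      using False by (simp_all add: T_def N_def)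
    have factor: "f x = c0 * (x - r) * (x\<^sup>2 - T * x + N)" for x
      using TN fr unfolding f_def power2_eq_square power3_eq_cube by Groebner_Basis.algebra
    show ?thesis
    proof (rule that)
      fix x
      show "x\<^sup>2 - T * x + N \<noteq> 0"
      proof
        assume x: "x\<^sup>2 - T * x + N = 0"
        \<comment> \<open>\<open>T - x\<close> is the other root of the quadratic. Both must equal
          \<open>r\<close>, so \<open>f\<close> is \<open>c0\<close> times the cube of
          \<open>x - r\<close> and has \<open>c1 = c2 = 0\<close>.\<close>
        then have "(T - x)\<^sup>2 - T * (T - x) + N = 0" by Groebner_Basis.algebra
        with x have "f x = 0" "f (T - x) = 0" by (simp_all add: factor)
        with r have "x = r" "T - x = r" by auto
        then have T: "T = r + r" by (simp add: diff_eq_eq)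
        have N: "N = r\<^sup>2" using x unfolding T \<open>x = r\<close> by (simp add: algebra_simps power2_eq_square)
        have "c1 = - (3 * (c0 * r))" using TN(1) T by Groebner_Basis.algebra
        with three have "c1 = 0" by simp
        moreover have "c2 = 0" using TN(2) N calculation by simp
        ultimately show False using nG by simp
      qed
    next
      have "c2 = c0 * N - (c1 + c0 * T) * T" "c3 = (c1 + c0 * T) * N"
        using TN fr False unfolding f_def power2_eq_square power3_eq_cube by Groebner_Basis.algebra+
      then show "conj_line T N \<subseteq> \<pi>"
        unfolding c conj_line_subset_proj_plane_iff by blast
    next
      fix T' N' assume irr: "\<And>x. x\<^sup>2 - T' * x + N' \<noteq> 0" and sub: "conj_line T' N' \<subseteq> \<pi>"
      have c': "c2 = c0 * N' - (c1 + c0 * T') * T'" "c3 = (c1 + c0 * T') * N'"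
        using sub unfolding c conj_line_subset_proj_plane_iff by blast+
      have "f r = (c0 * r + (c1 + c0 * T')) * (r\<^sup>2 - T' * r + N')"
        unfolding f_def c' by (simp add: algebra_simps power2_eq_square power3_eq_cube)
      \<comment> \<open>The quadratic does not vanish at \<open>r\<close>, so the linear factor
        does; this determines \<open>T'\<close> and then \<open>N'\<close>.\<close>
      with irr fr have r': "c0 * r + (c1 + c0 * T') = 0" by simp
      with TN have "c0 * T' = c0 * T" by Groebner_Basis.algebra
      with False have T': "T' = T" by simp
      have "c0 * N' = c0 * N" using c'(1) TN r' T' by Groebner_Basis.algebra
      with False T' show "T' = T \<and> N' = N" by simp
    qed
  qed
qed

section \<open>The Frobenius map and descent of imaginary chords to the ground field\<close>

lemma power_CARD_eq:
  fixes x :: "'a::{field,finite}"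
  shows "x ^ CARD('a) = x"
proof (cases "x = 0")
  case False
  let ?A = "UNIV - {0 :: 'a}"
  have "(\<Prod>y\<in>?A. x * y) = \<Prod>?A"
    by (rule prod.reindex_bij_witness[of _ "\<lambda>y. y / x" "\<lambda>y. x * y"]) (use False in auto)
  then have "x ^ card ?A = 1"
    by (simp add: prod.distrib)
  moreover have "CARD('a) = Suc (card ?A)"
    by (simp add: card_Diff_singleton finite_UNIV_card_ge_0)
  ultimately show ?thesis by (metis power_Suc mult.right_neutral)
qed (simp add: finite_UNIV_card_ge_0)

context
  fixes h :: nat and F :: "'a::{field,finite} alg_closure \<Rightarrow> 'a alg_closure"
  assumes card_eq: "CARD('a) = 3 ^ h"
  defines "F \<equiv> \<lambda>x. x ^ CARD('a)"
begin

lemma frobenius_add: "F (x + y) = F x + F y"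
proof -
  have "CHAR('a) dvd 3"
    using three_eq_0[OF card_eq] of_nat_eq_0_iff_char_dvd[where 'a = 'a and n = 3] by simp
  then have "CHAR('a) = 3"
    using prime_nat_iff[of 3] CHAR_not_1'[where 'a = 'a] by auto
  then have "CHAR('a alg_closure) = 3" by simp
  then show ?thesis
    unfolding F_def card_eq by (intro freshmans_dream') simp_all
qed

lemma frobenius_mult: "F (x * y) = F x * F y"
  by (simp add: F_def power_mult_distrib)

lemma frobenius_to_ac: "F (to_ac a) = to_ac a"
  by (simp add: F_def power_CARD_eq flip: to_ac_power)

lemma frobenius_diff: "F (x - y) = F x - F y"
  using frobenius_add[of "x - y" y] by (simp add: algebra_simps)

lemma frobenius_frobenius: "F (F x) = x ^ (CARD('a)\<^sup>2)"
  by (simp add: F_def power2_eq_square power_mult)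

text \<open>The polynomial \<open>x^q - x\<close> has at most \<open>q\<close> roots, and the ground
  field already supplies \<open>q\<close> of them.\<close>

lemma frobenius_fixed:
  assumes "F x = x"
  shows "x \<in> range to_ac"
proof -
  let ?p = "Polynomial.monom 1 CARD('a) + [:0, - 1:] :: 'a alg_closure poly"
  have q: "CARD('a) > 1"
    using card_mono[of UNIV "{0, 1 :: 'a}"] by simp
  have deg: "Polynomial.degree ?p = CARD('a)"
    using q by (subst Polynomial.degree_add_eq_left) (auto simp: Polynomial.degree_monom_eq)
  then have nz: "?p \<noteq> 0" using q by auto
  have roots: "{x. poly ?p x = 0} = {x. F x = x}"
    by (simp add: F_def poly_monom)
  have "card {x. F x = x} \<le> CARD('a)"
    using card_poly_roots_bound[OF nz] deg roots by simp
  moreover have "card (range (to_ac :: 'a \<Rightarrow> _)) = CARD('a)"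
    by (rule card_image[OF inj_to_ac])
  moreover have "finite {x. F x = x}"
    using poly_roots_finite[OF nz] roots by simp
  moreover have "range to_ac \<subseteq> {x. F x = x}"
    using frobenius_to_ac by auto
  ultimately have "range to_ac = {x. F x = x}"
    by (intro card_seteq) auto
  with assms show ?thesis by blast
qed

text \<open>Both conjugate points satisfy the recurrences, hence so does their span. Conversely a
  solution is determined by its last two coordinates, which some combination of the two points
  matches because \<open>s\<close> and \<open>F s\<close> differ.\<close>

lemma imaginary_chord_eq_conj_line:
  assumes "s \<noteq> F s" and T: "s + F s = to_ac T" and N: "s * F s = to_ac N"
  shows "imaginary_chord s = conj_line T N"
proof -
  let ?v = "\<lambda>s :: 'a alg_closure. vector [s ^ 3, s\<^sup>2, s, 1] :: 'a alg_closure ^ 4"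
  define s' where "s' = F s"
  have span: "vec.span (proj_point (s ^ 3) (s\<^sup>2) s 1 \<union> proj_point (s' ^ 3) (s'\<^sup>2) s' 1) =
      {x + y |x y. x \<in> range (\<lambda>k. k *s ?v s) \<and> y \<in> range (\<lambda>k. k *s ?v s')}"
    unfolding proj_point_def vec.span_Un vec.span_span unfolding vec.span_singleton ..
  have mem: "v \<in> imaginary_chord s \<longleftrightarrow> (\<exists>a b. to_ac (v $ 1) = a * s ^ 3 + b * s' ^ 3 \<and>
      to_ac (v $ 2) = a * s\<^sup>2 + b * s'\<^sup>2 \<and> to_ac (v $ 3) = a * s + b * s' \<and>
      to_ac (v $ 4) = a + b)" for v
  proof -
    have "v \<in> imaginary_chord s \<longleftrightarrow> (\<chi> i. to_ac (v $ i)) \<in>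
        vec.span (proj_point (s ^ 3) (s\<^sup>2) s 1 \<union> proj_point (s' ^ 3) (s'\<^sup>2) s' 1)"
      by (simp only: imaginary_chord_def mem_Collect_eq Let_def s'_def F_def)
    also have "\<dots> \<longleftrightarrow> (\<exists>a b. (\<chi> i. to_ac (v $ i)) = a *s ?v s + b *s ?v s')"
      unfolding span by blast
    also have "\<dots> \<longleftrightarrow> (\<exists>a b. to_ac (v $ 1) = a * s ^ 3 + b * s' ^ 3 \<and>
      to_ac (v $ 2) = a * s\<^sup>2 + b * s'\<^sup>2 \<and> to_ac (v $ 3) = a * s + b * s' \<and>
      to_ac (v $ 4) = a + b)"
      by (simp add: vec_eq_iff forall_4)
    finally show ?thesis .
  qed
  have line: "v \<in> conj_line T N \<longleftrightarrow>
      to_ac (v $ 1) - (s + s') * to_ac (v $ 2) + s * s' * to_ac (v $ 3) = 0 \<and>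
      to_ac (v $ 2) - (s + s') * to_ac (v $ 3) + s * s' * to_ac (v $ 4) = 0" for v
    unfolding s'_def T N conj_line_def
    by (simp flip: to_ac_mult to_ac_diff to_ac_add)
  show ?thesis
  proof (intro equalityI subsetI)
    fix v assume "v \<in> imaginary_chord s"
    then show "v \<in> conj_line T N"
      unfolding mem line by (auto simp: algebra_simps power2_eq_square power3_eq_cube)
  next
    fix v assume v: "v \<in> conj_line T N"
    \<comment> \<open>Cramer's rule for the last two coordinates, \<open>a + b\<close> and
      \<open>a s + b s'\<close>.\<close>
    define a b where "a = (to_ac (v $ 3) - s' * to_ac (v $ 4)) / (s - s')"
      and "b = (s * to_ac (v $ 4) - to_ac (v $ 3)) / (s - s')"
    have d: "s - s' \<noteq> 0" using assms(1) by (simp add: s'_def)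
    have "a * (s - s') = to_ac (v $ 3) - s' * to_ac (v $ 4)"
      "b * (s - s') = s * to_ac (v $ 4) - to_ac (v $ 3)"
      using d by (simp_all add: a_def b_def)
    then have "(s - s') * (a + b) = (s - s') * to_ac (v $ 4)"
      "(s - s') * (a * s + b * s') = (s - s') * to_ac (v $ 3)"
      by Groebner_Basis.algebra+
    with d have v4: "to_ac (v $ 4) = a + b" and v3: "to_ac (v $ 3) = a * s + b * s'" by simp_all
    have v2: "to_ac (v $ 2) = a * s\<^sup>2 + b * s'\<^sup>2"
      using v v3 v4 unfolding line by Groebner_Basis.algebra
    have v1: "to_ac (v $ 1) = a * s ^ 3 + b * s' ^ 3"
      using v v2 v3 unfolding line by Groebner_Basis.algebra
    from v1 v2 v3 v4 show "v \<in> imaginary_chord s" unfolding mem by blast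
  qed
qed

text \<open>Trace and norm of \<open>s\<close> are fixed by the Frobenius map, hence lie in the
  ground field. Conversely, a rootless quadratic has a root \<open>s\<close> in the closure, and
  \<open>F s\<close> is the other one.\<close>

lemma imaginary_chords_eq:
  "(imaginary_chords :: ('a ^ 4) set set) =
    (\<lambda>(T, N). conj_line T N) ` {(T, N). \<forall>x. x\<^sup>2 - T * x + N \<noteq> 0}"
proof (intro equalityI subsetI)
  fix l :: "('a ^ 4) set" assume "l \<in> imaginary_chords"
  then obtain s where l: "l = imaginary_chord s" and s: "F (F s) = s" "s \<notin> range to_ac"
    by (auto simp: imaginary_chords_def quadratic_extension_def frobenius_frobenius)
  have "s + F s \<in> range to_ac" "s * F s \<in> range to_ac"
    using s by (intro frobenius_fixed, simp add: frobenius_add frobenius_mult ac_simps)+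
  then obtain T N where TN: "s + F s = to_ac T" "s * F s = to_ac N" by auto
  have "x\<^sup>2 - T * x + N \<noteq> 0" for x
  proof
    assume "x\<^sup>2 - T * x + N = 0"
    then have "to_ac (x\<^sup>2 - T * x + N) = 0" by simp
    then have "(to_ac x - s) * (to_ac x - F s) = 0"
      by (simp add: algebra_simps power2_eq_square flip: TN)
    then have "s \<in> range to_ac \<or> F s = to_ac x" by auto
    then show False using s frobenius_to_ac by (metis rangeI)
  qed
  moreover have "s \<noteq> F s" using s(2) frobenius_fixed by metis
  ultimately show "l \<in> (\<lambda>(T, N). conj_line T N) ` {(T, N). \<forall>x. x\<^sup>2 - T * x + N \<noteq> 0}"
    using imaginary_chord_eq_conj_line[OF _ TN] l by auto
next
  fix l :: "('a ^ 4) set"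
  assume "l \<in> (\<lambda>(T, N). conj_line T N) ` {(T, N). \<forall>x. x\<^sup>2 - T * x + N \<noteq> 0}"
  then obtain T N where l: "l = conj_line T N" and irr: "\<And>x. x\<^sup>2 - T * x + N \<noteq> 0" by auto
  obtain s where "poly [:to_ac N, - to_ac T, 1:] s = 0"
    using alg_closed_imp_poly_has_root[of "[:to_ac N, - to_ac T, 1:]"] by auto
  then have s: "s * s - to_ac T * s + to_ac N = 0" by (simp add: algebra_simps)
  have s_notin: "s \<notin> range to_ac"
  proof
    assume "s \<in> range to_ac"
    then obtain x where "s = to_ac x" by auto
    with s have "to_ac (x\<^sup>2 - T * x + N) = 0" by (simp add: power2_eq_square)
    with irr[of x] show False by (simp only: to_ac_eq_0_iff)
  qed
  then have neq: "s \<noteq> F s" using frobenius_fixed by metis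
  have "F (s * s - to_ac T * s + to_ac N) = 0" using s by (simp add: F_def)
  \<comment> \<open>\<open>F\<close> fixes the coefficients, so \<open>F s\<close> is a root too;
    subtracting the two equations gives the trace.\<close>
  then have "F s * F s - to_ac T * F s + to_ac N = 0"
    by (simp add: frobenius_add frobenius_diff frobenius_mult frobenius_to_ac)
  with s have "(s - F s) * (s + F s - to_ac T) = 0" by Groebner_Basis.algebra
  with neq have T: "s + F s = to_ac T" by simp
  with s have N: "s * F s = to_ac N" by Groebner_Basis.algebra
  \<comment> \<open>Invariance of the trace forces \<open>F (F s) = s\<close>, which places
    \<open>s\<close> in the quadratic extension.\<close>
  have "F (s + F s) = s + F s" by (simp add: T frobenius_to_ac)
  then have "F s + F (F s) = s + F s" by (simp only: frobenius_add)
  then have "s ^ (CARD('a)\<^sup>2) = s" by (simp add: frobenius_frobenius)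
  then have "s \<in> quadratic_extension - range to_ac"
    using s_notin by (simp add: quadratic_extension_def)
  then show "l \<in> imaginary_chords"
    unfolding l imaginary_chord_eq_conj_line[OF neq T N, symmetric] imaginary_chords_def by blast
qed

end

section \<open>Counting planes and external lines\<close>

context
  fixes q h :: nat
  assumes q_def: "q = CARD('a::{field,finite})" and q_eq: "q = 3 ^ h" and q_ge: "q \<ge> 5"
begin

lemma q3: "CARD('a) \<ge> 3" and three: "(3 :: 'a) = 0"
  using q_def q_ge q_eq three_eq_0[where 'a = 'a and h = h] by auto

lemma sum_choose_planes:
  assumes "k \<le> 3"
  shows "(\<Sum>\<pi>\<in>(proj_planes :: ('a ^ 4) set set). real (cubic_number \<pi> choose k)) =
    real ((q + 1) choose k) * (\<Sum>i<4 - k. real q ^ i)"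
proof -
  have c: "card (subspaces_between U UNIV 3) = (\<Sum>i<4 - k. q ^ i)"
    if "vec.subspace U" "vec.dim U = k" for U :: "('a ^ 4) set"
    using card_hyperplanes_between[of U UNIV] that assms dim_UNIV_4[where 'a = 'a]
    by (simp add: q_def)
  have "(\<Sum>\<pi>\<in>subspaces_between {0} (UNIV :: ('a ^ 4) set) 3. cubic_number \<pi> choose k) =
      (cubic_number (UNIV :: ('a ^ 4) set) choose k) * (\<Sum>i<4 - k. q ^ i)"
    using q3 assms c by (intro sum_choose_cubic_number) auto
  then have "(\<Sum>\<pi>\<in>(proj_planes :: ('a ^ 4) set set). cubic_number \<pi> choose k) =
      ((q + 1) choose k) * (\<Sum>i<4 - k. q ^ i)"
    by (simp add: proj_planes_eq cubic_number_def card_twisted_cubic q_def)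
  from arg_cong[OF this, of real] show ?thesis by simp
qed

lemma card_planes:
  "real (card (d_planes 3 :: ('a ^ 4) set set)) = (real q + 1) * real q * (real q - 1) / 6" (is ?g3)
  "real (card (d_planes 0 :: ('a ^ 4) set set)) = (real q + 1) * real q * (real q - 1) / 3" (is ?g0)
  "real (card (one_bar_planes :: ('a ^ 4) set set)) = (real q + 1) * real q * (real q - 1) / 2" (is ?g1)
proof -
  let ?P = "proj_planes :: ('a ^ 4) set set"
  have le: "cubic_number \<pi> \<le> 3" if "\<pi> \<in> ?P" for \<pi>
    using card_cubic_points_in_plane_le[OF that] by (simp add: cubic_number_def)
  have d: "d_planes n = {\<pi> \<in> ?P. cubic_number \<pi> = n}" for n
    by (auto simp: d_planes_def cubic_number_def)
  have pow: "(\<Sum>i<4 - 0. x ^ i) = 1 + x + x ^ 2 + x ^ 3" "(\<Sum>i<4 - 1. x ^ i) = 1 + x + x ^ 2"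
    "(\<Sum>i<4 - 2. x ^ i) = 1 + x" "(\<Sum>i<4 - 3. x ^ i) = 1" for x :: real
    by (simp_all add: numeral_eq_Suc)
  have s: "(\<Sum>\<pi>\<in>?P. real (cubic_number \<pi> choose 0)) = (real q + 1) * (real q ^ 2 + 1)"
    "(\<Sum>\<pi>\<in>?P. real (cubic_number \<pi> choose 1)) = (real q + 1) * (real q ^ 2 + real q + 1)"
    "(\<Sum>\<pi>\<in>?P. real (cubic_number \<pi> choose 2)) = (real q + 1) * real q / 2 * (real q + 1)"
    "(\<Sum>\<pi>\<in>?P. real (cubic_number \<pi> choose 3)) = (real q + 1) * real q * (real q - 1) / 6"
    using sum_choose_planes[of 0] sum_choose_planes[of 1] sum_choose_planes[of 2] sum_choose_planes[of 3]
    unfolding pow choose_2_real choose_3_real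
    by (simp_all add: field_simps power2_eq_square power3_eq_cube)
  have small: "(0 :: nat) choose 2 = 0" "(0 :: nat) choose 3 = 0" "Suc 0 choose 2 = 0" "Suc 0 choose 3 = 0"
    "(2 :: nat) choose 3 = 0" "(3 :: nat) choose 2 = 3"
    by (simp_all add: numeral_eq_Suc)
  have cases: "P (cubic_number \<pi>)" if "P 0" "P 1" "P 2" "P 3" "\<pi> \<in> ?P" for P \<pi>
    using le[OF that(5)] that by (auto simp: numeral_eq_Suc le_Suc_eq)
  \<comment> \<open>on \<open>{0..3}\<close> the indicator of \<open>i = d\<close> is a combination of the \<open>i choose k\<close>\<close>
  have "real (card (d_planes 3 :: ('a ^ 4) set set)) = (\<Sum>\<pi>\<in>?P. real (cubic_number \<pi> choose 3))"
    unfolding d card_filter_real[OF finite]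
    by (intro sum.cong refl) (rule cases, simp_all add: small)
  then show ?g3 using s by simp
  have "real (card (d_planes 0 :: ('a ^ 4) set set)) = (\<Sum>\<pi>\<in>?P. real (cubic_number \<pi> choose 0) -
      real (cubic_number \<pi> choose 1) + real (cubic_number \<pi> choose 2) - real (cubic_number \<pi> choose 3))"
    unfolding d card_filter_real[OF finite]
    by (intro sum.cong refl) (rule cases, simp_all add: small)
  also have "\<dots> = (real q + 1) * real q * (real q - 1) / 3"
    unfolding sum.distrib sum_subtractf s by (simp add: field_simps power2_eq_square)
  finally show ?g0 .
  have "real (card (d_planes 1 :: ('a ^ 4) set set)) = (\<Sum>\<pi>\<in>?P. real (cubic_number \<pi> choose 1) -
      2 * real (cubic_number \<pi> choose 2) + 3 * real (cubic_number \<pi> choose 3))"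
    unfolding d card_filter_real[OF finite]
    by (intro sum.cong refl) (rule cases, simp_all add: small)
  also have "\<dots> = (\<Sum>\<pi>\<in>?P. real (cubic_number \<pi> choose 1)) -
      2 * (\<Sum>\<pi>\<in>?P. real (cubic_number \<pi> choose 2)) + 3 * (\<Sum>\<pi>\<in>?P. real (cubic_number \<pi> choose 3))"
    by (simp only: sum.distrib sum_subtractf sum_distrib_left)
  also have "\<dots> = (real q + 1) * real q * (real q - 1) / 2 + (real q + 1)"
    unfolding s by (simp add: algebra_simps power2_eq_square add_divide_distrib diff_divide_distrib)
  finally have d1: "real (card (d_planes 1 :: ('a ^ 4) set set)) =
      (real q + 1) * real q * (real q - 1) / 2 + (real q + 1)" .
  \<comment> \<open>The one-point planes still include the osculating ones; these are the
    \<open>q + 1\<close> planes through the axis and are subtracted.\<close>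
  have A: "vec.subspace (Gamma_axis :: ('a ^ 4) set)" "vec.dim (Gamma_axis :: ('a ^ 4) set) = 2"
    using Gamma_axis_in_proj_lines[OF three] by (auto simp: proj_lines_def)
  have "(Gamma_planes :: ('a ^ 4) set set) = subspaces_between Gamma_axis UNIV 3"
    by (auto simp: Gamma_planes_eq[OF three] subspaces_between_def proj_planes_def)
  moreover have "card (subspaces_between (Gamma_axis :: ('a ^ 4) set) UNIV 3) = q + 1"
    using card_hyperplanes_between[of "Gamma_axis :: ('a ^ 4) set" UNIV] A dim_UNIV_4[where 'a = 'a]
    by (simp add: q_def numeral_2_eq_2)
  moreover have "Gamma_planes \<subseteq> (d_planes 1 :: ('a ^ 4) set set)"
    using card_cubic_points_in_Gamma_plane[OF three] by (auto simp: d_planes_def Gamma_planes_eq[OF three])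
  moreover have "real (card (A - B)) = real (card A) - real (card B)" if "B \<subseteq> A" for A B :: "('a ^ 4) set set"
    using that card_mono[of A B] by (simp add: card_Diff_subset of_nat_diff)
  ultimately have "real (card (one_bar_planes :: ('a ^ 4) set set)) =
      real (card (d_planes 1 :: ('a ^ 4) set set)) - (real q + 1)"
    unfolding one_bar_planes_def by (metis of_nat_1 of_nat_add)
  then show ?g1 using d1 by simp
qed

section \<open>Osculating planes and lines meeting the axis\<close>

abbreviation axis :: "('a ^ 4) set" where "axis \<equiv> Gamma_axis"

lemma subspace_axis: "vec.subspace axis" and dim_axis: "vec.dim axis = 2"
  using Gamma_axis_in_proj_lines[OF three] by (auto simp: proj_lines_def)

lemma cubic_point_not_subset_axis:
  assumes "p \<in> twisted_cubic"
  shows "\<not> p \<subseteq> axis"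
  using assms by (auto simp: twisted_cubic_def proj_point_subset_iff[OF subspace_axis])
    (auto simp: Gamma_axis_char_3[OF three])

lemma axis_in_external_lines: "axis \<in> external_lines"
  using Gamma_axis_in_proj_lines[OF three] cubic_point_not_subset_axis
  by (auto simp: external_lines_def)

lemma card_planes_through:
  assumes "vec.subspace (U :: ('a ^ 4) set)" "vec.dim U \<le> 3"
  shows "card {\<pi> \<in> proj_planes. U \<subseteq> \<pi>} = (\<Sum>i<4 - vec.dim U. q ^ i)"
proof -
  have "{\<pi> \<in> proj_planes. U \<subseteq> \<pi>} = subspaces_between U UNIV 3"
    by (auto simp: proj_planes_def subspaces_between_def)
  then show ?thesis
    using card_hyperplanes_between[of U UNIV] assms dim_UNIV_4[where 'a = 'a] by (simp add: q_def)
qed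

text \<open>A plane contains \<open>l\<close> and the axis iff it contains their join, whose
  dimension is 4, 2 or 3 in the three cases.\<close>

lemma card_Gamma_planes_through:
  assumes "l \<in> proj_lines"
  shows "card {\<pi> \<in> Gamma_planes. l \<subseteq> \<pi>} =
    (if vec.dim (l \<inter> axis) = 0 then 0 else if l = axis then q + 1 else 1)"
proof -
  have l: "vec.subspace l" "vec.dim l = 2" using assms by (auto simp: proj_lines_def)
  let ?W = "subspace_sum l axis"
  note W = subspace_sum[OF l(1) subspace_axis]
  have dim: "vec.dim ?W + vec.dim (l \<inter> axis) = 4"
    using W(5) l(2) dim_axis by simp
  have eq: "{\<pi> \<in> Gamma_planes. l \<subseteq> \<pi>} = {\<pi> \<in> proj_planes. ?W \<subseteq> \<pi>}"
    using W(4) by (auto simp: Gamma_planes_eq[OF three] proj_planes_def simp del: subset_iff)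
  consider "vec.dim (l \<inter> axis) = 0" | "vec.dim (l \<inter> axis) > 0" "l = axis"
    | "vec.dim (l \<inter> axis) > 0" "l \<noteq> axis" by blast
  then show ?thesis
  proof cases
    case 1
    have "\<not> ?W \<subseteq> \<pi>" if "\<pi> \<in> proj_planes" for \<pi>
      using that vec.dim_subset[of ?W \<pi>] dim 1 by (auto simp: proj_planes_def)
    then have "{\<pi> \<in> proj_planes. ?W \<subseteq> \<pi>} = {}" by blast
    then show ?thesis unfolding eq using 1 by (simp del: vec.dim_eq_0)
  next
    case 2
    then have "vec.dim ?W = 2" using dim dim_axis by simp
    then show ?thesis
      unfolding eq using card_planes_through[OF W(1)] 2 by (simp add: numeral_2_eq_2 del: vec.dim_eq_0)
  next
    case 3
    have "vec.dim (l \<inter> axis) \<noteq> 2"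
    proof
      assume "vec.dim (l \<inter> axis) = 2"
      then have "l \<inter> axis = l" "l \<inter> axis = axis"
        using l subspace_axis dim_axis vec.subspace_dim_equal[of "l \<inter> axis"]
        by (simp_all add: vec.subspace_inter)
      then show False using 3 by blast
    qed
    moreover have "vec.dim (l \<inter> axis) \<le> 2"
      using vec.dim_subset[of "l \<inter> axis" l] l by simp
    ultimately have "vec.dim ?W = 3" using dim 3 by linarith
    then show ?thesis
      unfolding eq using card_planes_through[OF W(1)] 3 by (simp del: vec.dim_eq_0)
  qed
qed

lemma meets_axis_iff:
  assumes "l \<in> proj_lines"
  shows "(\<exists>p\<in>proj_points. p \<subseteq> l \<and> p \<subseteq> axis) \<longleftrightarrow> (\<exists>\<pi>\<in>Gamma_planes. l \<subseteq> \<pi>)"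
proof -
  have "(\<exists>p\<in>proj_points. p \<subseteq> l \<and> p \<subseteq> axis) \<longleftrightarrow> vec.dim (l \<inter> axis) > 0"
    using meets_subspace_iff[OF _ subspace_axis, of l] assms
    by (auto simp: proj_points_def proj_lines_def simp del: subset_iff)
  also have "\<dots> \<longleftrightarrow> card {\<pi> \<in> Gamma_planes. l \<subseteq> \<pi>} \<noteq> 0"
    using card_Gamma_planes_through[OF assms] by (simp del: vec.dim_eq_0)
  also have "\<dots> \<longleftrightarrow> (\<exists>\<pi>\<in>Gamma_planes. l \<subseteq> \<pi>)"
    by (subst card_0_eq) auto
  finally show ?thesis .
qed

lemma EA_lines_eq:
  "EA_lines = {l \<in> external_lines. l \<noteq> axis \<and> (\<exists>\<pi>\<in>Gamma_planes. l \<subseteq> \<pi>)}"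
proof -
  have "external_lines \<subseteq> (proj_lines :: ('a ^ 4) set set)" by (auto simp: external_lines_def)
  then show ?thesis unfolding EA_lines_def using meets_axis_iff by blast
qed

text \<open>A line has \<open>n \<le> 2\<close> cubic points, and for such \<open>n\<close> the
  indicator of \<open>n = 0\<close> is \<open>1 - n + (n choose 2)\<close>. The three terms sum to
  all lines, to \<open>N1\<close> lines per cubic point, and to one line per pair of cubic
  points.\<close>

lemma card_external_lines_in:
  fixes V :: "('a ^ 4) set"
  assumes V: "vec.subspace V"
    and N0: "card {l \<in> proj_lines. l \<subseteq> V} = N0"
    and N1: "\<And>U. vec.subspace U \<Longrightarrow> U \<subseteq> V \<Longrightarrow> vec.dim U = 1 \<Longrightarrow> card (subspaces_between U V 2) = N1"
  shows "real (lines_in external_lines V) =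
    real N0 - real (cubic_number V) * real N1 + real (cubic_number V choose 2)"
proof -
  let ?B = "{l \<in> proj_lines. l \<subseteq> V}"
  have le: "cubic_number l \<le> 2" if "l \<in> ?B" for l
    using card_cubic_points_in_subspace_le[of l] that q3 by (auto simp: cubic_number_def proj_lines_def)
  have s1: "(\<Sum>l\<in>?B. cubic_number l choose 1) = (cubic_number V choose 1) * N1"
    unfolding proj_lines_in_eq by (rule sum_choose_cubic_number[OF V q3]) (use N1 in auto)
  have s2: "(\<Sum>l\<in>?B. cubic_number l choose 2) = (cubic_number V choose 2) * 1"
    unfolding proj_lines_in_eq
  proof (rule sum_choose_cubic_number[OF V q3])
    fix U :: "('a ^ 4) set" assume "vec.subspace U" "U \<subseteq> V" "vec.dim U = 2"
    then show "card (subspaces_between U V 2) = 1"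
      using subspaces_between_self[of U V] by simp
  qed simp
  have "{l \<in> external_lines. l \<subseteq> V} = {l \<in> ?B. cubic_number l = 0}"
    by (auto simp: external_lines_eq)
  then have "real (lines_in external_lines V) = (\<Sum>l\<in>?B. if cubic_number l = 0 then 1 else 0)"
    by (simp only: lines_in_def card_filter_real[OF finite])
  also have "\<dots> = (\<Sum>l\<in>?B. 1 - real (cubic_number l choose 1) + real (cubic_number l choose 2))"
  proof (rule sum.cong[OF refl])
    fix l assume "l \<in> ?B"
    from le[OF this] consider "cubic_number l = 0" | "cubic_number l = 1" | "cubic_number l = 2" by linarith
    then show "(if cubic_number l = 0 then 1 else 0) =
        1 - real (cubic_number l choose 1) + real (cubic_number l choose 2)"
      by cases (simp_all add: numeral_2_eq_2)
  qed
  also have "\<dots> = real N0 - real (\<Sum>l\<in>?B. cubic_number l choose 1) + real (\<Sum>l\<in>?B. cubic_number l choose 2)"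
    by (simp add: sum.distrib sum_subtractf N0)
  finally show ?thesis unfolding s1 s2 by simp
qed

lemma external_lines_in_plane:
  assumes "(\<pi> :: ('a ^ 4) set) \<in> proj_planes"
  shows "real (lines_in external_lines \<pi>) = real q ^ 2 + real q + 1 -
    real (cubic_number \<pi>) * (real q + 1) + real (cubic_number \<pi> choose 2)"
proof -
  have \<pi>: "vec.subspace \<pi>" "vec.dim \<pi> = 3" using assms by (auto simp: proj_planes_def)
  have "card {l \<in> proj_lines. l \<subseteq> \<pi>} = q ^ 2 + q + 1"
    using card_hyperplanes_between[of "{0}" \<pi>] \<pi> vec.subspace_0[OF \<pi>(1)]
    by (simp add: proj_lines_in_eq q_def numeral_eq_Suc)
  moreover have "card (subspaces_between U \<pi> 2) = q + 1"
    if "vec.subspace U" "U \<subseteq> \<pi>" "vec.dim U = 1" for U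
    using card_hyperplanes_between[of U \<pi>] \<pi> that by (simp add: q_def numeral_eq_Suc)
  ultimately show ?thesis
    using card_external_lines_in[OF \<pi>(1)] by simp
qed

lemma card_external_lines:
  "real (card (external_lines :: ('a ^ 4) set set)) =
    (real q ^ 2 + 1) * (real q ^ 2 + real q + 1) - (real q + 1) * (real q ^ 2 + real q + 1) +
    (real q + 1) * real q / 2"
proof -
  have pt: "card (subspaces_between U UNIV 2) = q ^ 2 + q + 1"
    if "vec.subspace U" "vec.dim U = 1" for U :: "('a ^ 4) set"
    using card_subspaces_between_Suc[of U UNIV] that dim_UNIV_4[where 'a = 'a]
    by (simp add: q_def numeral_eq_Suc)
  \<comment> \<open>Flags of a point and a line: each point lies on \<open>q^2 + q + 1\<close> lines
    and each line has \<open>q + 1\<close> points.\<close>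
  have "card (subspaces_between {0 :: 'a ^ 4} UNIV 2) * (\<Sum>i<2 - vec.dim {0 :: 'a ^ 4}. CARD('a) ^ i) =
      (\<Sum>i<vec.dim (UNIV :: ('a ^ 4) set) - vec.dim {0 :: 'a ^ 4}. CARD('a) ^ i) * (q ^ 2 + q + 1)"
    using pt by (intro card_subspaces_between_step) (auto simp: subspaces_between_def)
  then have "card (subspaces_between {0 :: 'a ^ 4} UNIV 2) * (q + 1) =
      ((q ^ 2 + 1) * (q ^ 2 + q + 1)) * (q + 1)"
    using dim_UNIV_4[where 'a = 'a] by (simp add: q_def numeral_eq_Suc algebra_simps)
  then have "card (subspaces_between {0 :: 'a ^ 4} UNIV 2) = (q ^ 2 + 1) * (q ^ 2 + q + 1)"
    by (simp only: mult_cancel2) simp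
  then have "card {l \<in> (proj_lines :: ('a ^ 4) set set). l \<subseteq> UNIV} = (q ^ 2 + 1) * (q ^ 2 + q + 1)"
    by (simp only: proj_lines_in_eq)
  note card_external_lines_in[OF vec.subspace_UNIV this pt]
  moreover have "cubic_number (UNIV :: ('a ^ 4) set) = q + 1"
    by (simp add: cubic_number_def card_twisted_cubic q_def)
  ultimately show ?thesis
    by (simp add: lines_in_def choose_2_real algebra_simps)
qed

text \<open>The plane meets the axis in one point \<open>R\<close>. Each of the \<open>q + 1\<close>
  lines of the plane through \<open>R\<close> lies in an osculating plane and so has at most one
  cubic point, while each cubic point of the plane is on exactly one of them. Thus every cubic point
  costs exactly one line.\<close>

lemma EA_lines_in_plane:
  assumes \<pi>: "\<pi> \<in> proj_planes" "\<pi> \<notin> Gamma_planes"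
  shows "real (lines_in EA_lines (\<pi> :: ('a ^ 4) set)) = real q + 1 - real (cubic_number \<pi>)"
proof -
  have s\<pi>: "vec.subspace \<pi>" "vec.dim \<pi> = 3" using \<pi> by (auto simp: proj_planes_def)
  have nA: "\<not> axis \<subseteq> \<pi>" using \<pi> by (simp add: Gamma_planes_eq[OF three])
  define R where "R = \<pi> \<inter> axis"
  have R: "vec.subspace R" "R \<subseteq> \<pi>" "R \<subseteq> axis"
    using s\<pi> subspace_axis by (auto simp: R_def vec.subspace_inter)
  have "vec.dim (subspace_sum \<pi> axis) \<le> 4"
    using vec.dim_subset[of "subspace_sum \<pi> axis" UNIV] dim_UNIV_4[where 'a = 'a] by simp
  then have "vec.dim R \<ge> 1"
    using subspace_sum(5)[OF s\<pi>(1) subspace_axis] s\<pi> dim_axis by (simp add: R_def)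
  moreover have "vec.dim R < 2"
    using vec.dim_subset[OF R(3)] dim_axis vec.subspace_dim_equal[OF R(1) subspace_axis R(3)] nA R(2)
    by (cases "vec.dim R = 2") auto
  ultimately have dR: "vec.dim R = 1" by simp
  let ?B = "subspaces_between R \<pi> 2"
  have B_line: "l \<in> proj_lines" "l \<subseteq> \<pi>" "R \<subseteq> l" "l \<noteq> axis" "\<exists>\<pi>\<in>Gamma_planes. l \<subseteq> \<pi>" if "l \<in> ?B" for l
  proof -
    show l: "l \<in> proj_lines" "l \<subseteq> \<pi>" "R \<subseteq> l" "l \<noteq> axis"
      using that nA by (auto simp: subspaces_between_def proj_lines_def)
    show "\<exists>\<pi>\<in>Gamma_planes. l \<subseteq> \<pi>"
      using meets_axis_iff[OF l(1)] l(3) R dR by (auto simp: proj_points_def)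
  qed
  have le: "cubic_number l \<le> 1" if l: "l \<in> ?B" for l
  proof -
    obtain \<gamma> where "\<gamma> \<in> Gamma_planes" "l \<subseteq> \<gamma>" using B_line(5)[OF l] by blast
    then have "cubic_number l \<le> card {p \<in> twisted_cubic. p \<subseteq> \<gamma>}"
      unfolding cubic_number_def by (intro card_mono) auto
    then show ?thesis
      using card_cubic_points_in_Gamma_plane[OF three \<open>\<gamma> \<in> Gamma_planes\<close>] by simp
  qed
  have "{l \<in> EA_lines. l \<subseteq> \<pi>} = {l \<in> ?B. cubic_number l = 0}"
  proof (intro equalityI subsetI)
    fix l assume "l \<in> {l \<in> EA_lines. l \<subseteq> \<pi>}"
    then have l: "l \<subseteq> \<pi>" "l \<in> proj_lines" "cubic_number l = 0"
      and "\<exists>p\<in>proj_points. p \<subseteq> l \<and> p \<subseteq> axis"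
      by (auto simp: EA_lines_def external_lines_eq)
    then obtain p where p: "p \<in> proj_points" "p \<subseteq> l" "p \<subseteq> R" unfolding R_def by blast
    then have "p = R"
      using R(1) dR by (intro vec.subspace_dim_equal) (auto simp: proj_points_def)
    with p l show "l \<in> {l \<in> ?B. cubic_number l = 0}"
      by (auto simp: subspaces_between_def proj_lines_def)
  next
    fix l assume "l \<in> {l \<in> ?B. cubic_number l = 0}"
    then show "l \<in> {l \<in> EA_lines. l \<subseteq> \<pi>}"
      using B_line[of l] by (simp add: EA_lines_eq external_lines_eq)
  qed
  then have "real (lines_in EA_lines \<pi>) = (\<Sum>l\<in>?B. if cubic_number l = 0 then 1 else 0)"
    by (simp only: lines_in_def card_filter_real[OF finite])
  also have "\<dots> = (\<Sum>l\<in>?B. 1 - real (cubic_number l))"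
    by (intro sum.cong refl) (use le in \<open>force simp: le_Suc_eq\<close>)
  also have "\<dots> = real (card ?B) - real (\<Sum>l\<in>?B. cubic_number l)"
    by (simp add: sum_subtractf)
  also have "card ?B = q + 1"
    using card_hyperplanes_between[OF R(1) s\<pi>(1) R(2)] s\<pi> dR by (simp add: q_def numeral_eq_Suc)
  also have "(\<Sum>l\<in>?B. cubic_number l) = cubic_number \<pi>"
  proof -
    let ?D = "{p \<in> twisted_cubic. p \<subseteq> \<pi>}"
    have "(\<Sum>l\<in>?B. card {p \<in> ?D. p \<subseteq> l} choose 1) = (card ?D choose 1) * 1"
    proof (rule sum_choose_incidences)
      fix S assume "S \<subseteq> ?D" "card S = 1"
      then obtain p where S: "S = {p}" and p: "p \<in> twisted_cubic" "p \<subseteq> \<pi>"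
        by (auto simp: card_1_singleton_iff)
      then have sp: "vec.subspace p" "vec.dim p = 1"
        using twisted_cubic_subset_proj_points by (auto simp: proj_points_def)
      obtain x where x: "x \<in> p" "x \<notin> R" using cubic_point_not_subset_axis[OF p(1)] R(3) by blast
      then have "x \<noteq> 0" using vec.subspace_0[OF R(1)] by metis
      then have px: "p = vec.span {x}" using point_eq_span[OF sp x(1)] by simp
      have in_B: "vec.span (insert x R) \<in> ?B"
        using span_insert_between[OF R(1) s\<pi>(1) R(2), of x] x p dR by (auto simp: numeral_2_eq_2)
      have "{l \<in> ?B. p \<subseteq> l} = {vec.span (insert x R)}"
      proof (intro equalityI subsetI)
        fix l assume "l \<in> {l \<in> ?B. p \<subseteq> l}"
        then show "l \<in> {vec.span (insert x R)}"
          using between_eq_span_insert[OF R(1), of l \<pi> x] x dR by (auto simp: numeral_2_eq_2)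
      next
        fix l assume "l \<in> {vec.span (insert x R)}"
        then show "l \<in> {l \<in> ?B. p \<subseteq> l}"
          using in_B px vec.span_mono[of "{x}" "insert x R"] by simp
      qed
      then show "card {b \<in> ?B. \<forall>p\<in>S. p \<subseteq> b} = 1" by (simp add: S)
    qed auto
    moreover have "{p \<in> ?D. p \<subseteq> l} = {p \<in> twisted_cubic. p \<subseteq> l}" if "l \<in> ?B" for l
      using B_line(2)[OF that] by auto
    ultimately show ?thesis by (simp add: cubic_number_def)
  qed
  finally show ?thesis by simp
qed

text \<open>Each EA-line lies in exactly one of the \<open>q + 1\<close> osculating planes, and such
  a plane has \<open>q^2\<close> external lines, one of them the axis.\<close>

lemma card_EA_lines: "real (card (EA_lines :: ('a ^ 4) set set)) = (real q + 1) * (real q ^ 2 - 1)"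
proof -
  let ?EA = "EA_lines :: ('a ^ 4) set set" and ?G = "Gamma_planes :: ('a ^ 4) set set"
  have one: "card {\<pi> \<in> ?G. l \<subseteq> \<pi>} = 1" if "l \<in> ?EA" for l
  proof -
    have "l \<in> proj_lines" "l \<noteq> axis" "\<exists>\<pi>\<in>?G. l \<subseteq> \<pi>"
      using that by (auto simp: EA_lines_eq external_lines_def)
    moreover from this have "card {\<pi> \<in> ?G. l \<subseteq> \<pi>} \<noteq> 0" by (subst card_0_eq) auto
    ultimately show ?thesis using card_Gamma_planes_through[of l] by (auto split: if_splits)
  qed
  have each: "real (card {l \<in> ?EA. l \<subseteq> \<pi>}) = real q ^ 2 - 1" if "\<pi> \<in> ?G" for \<pi>
  proof -
    have \<pi>: "\<pi> \<in> proj_planes" "axis \<subseteq> \<pi>" using that by (auto simp: Gamma_planes_eq[OF three])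
    have cn: "cubic_number \<pi> = 1"
      using card_cubic_points_in_Gamma_plane[OF three that] by (simp add: cubic_number_def)
    have "{l \<in> external_lines. l \<subseteq> \<pi>} = insert axis {l \<in> ?EA. l \<subseteq> \<pi>}"
      using that \<pi> axis_in_external_lines by (auto simp: EA_lines_eq)
    moreover have "axis \<notin> ?EA" by (simp add: EA_lines_def)
    ultimately have "real (lines_in external_lines \<pi>) = 1 + real (card {l \<in> ?EA. l \<subseteq> \<pi>})"
      by (simp add: lines_in_def)
    moreover have "real (lines_in external_lines \<pi>) = real q ^ 2"
      using external_lines_in_plane[OF \<pi>(1)] by (simp add: cn)
    ultimately show ?thesis by simp
  qed
  have "card ?EA = (\<Sum>l\<in>?EA. card {\<pi> \<in> ?G. l \<subseteq> \<pi>})" using one by simp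
  also have "\<dots> = (\<Sum>\<pi>\<in>?G. card {l \<in> ?EA. l \<subseteq> \<pi>})"
    by (intro sum_multicount_gen) auto
  finally have "real (card ?EA) = (\<Sum>\<pi>\<in>?G. real (card {l \<in> ?EA. l \<subseteq> \<pi>}))" by simp
  also have "\<dots> = real (card ?G) * (real q ^ 2 - 1)" using each by simp
  also have "card ?G = q + 1"
    using card_planes_through[OF subspace_axis] dim_axis
    by (simp add: Gamma_planes_eq[OF three] numeral_2_eq_2)
  finally show ?thesis by (simp add: add.commute)
qed

section \<open>Imaginary chords and En\<Gamma>-lines\<close>

lemma imaginary_chords_conj_lines:
  "(imaginary_chords :: ('a ^ 4) set set) =
    (\<lambda>(T, N). conj_line T N) ` {(T, N). \<forall>x. x\<^sup>2 - T * x + N \<noteq> 0}"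
  using q_def q_eq by (intro imaginary_chords_eq[where h = h]) simp

lemma imaginary_chord_in_external_lines:
  assumes "(l :: ('a ^ 4) set) \<in> imaginary_chords"
  shows "l \<in> external_lines"
  using assms conj_line_in_external_lines by (auto simp: imaginary_chords_conj_lines)

lemma plane_through_imaginary_chord:
  assumes "(l :: ('a ^ 4) set) \<in> imaginary_chords" "\<pi> \<in> proj_planes" "l \<subseteq> \<pi>"
  shows "\<pi> \<in> one_bar_planes"
  using assms plane_through_conj_line_in_one_bar_planes[OF _ three]
  by (auto simp: imaginary_chords_conj_lines simp del: subset_iff)

lemma imaginary_chords_in_one_bar_plane:
  assumes "(\<pi> :: ('a ^ 4) set) \<in> one_bar_planes"
  shows "lines_in imaginary_chords \<pi> = 1"
proof -
  obtain T N where TN: "\<And>x. x\<^sup>2 - T * x + N \<noteq> 0" "conj_line T N \<subseteq> \<pi>"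
    and unique: "\<And>T' N'. (\<And>x. x\<^sup>2 - T' * x + N' \<noteq> 0) \<Longrightarrow> conj_line T' N' \<subseteq> \<pi> \<Longrightarrow> T' = T \<and> N' = N"
    using one_bar_plane_contains_conj_line[OF three assms] by metis
  have "{l \<in> imaginary_chords. l \<subseteq> \<pi>} = {conj_line T N}"
  proof (intro equalityI subsetI)
    fix l assume "l \<in> {l \<in> imaginary_chords. l \<subseteq> \<pi>}"
    then obtain T' N' where "\<And>x. x\<^sup>2 - T' * x + N' \<noteq> 0" "l = conj_line T' N'" "l \<subseteq> \<pi>"
      by (auto simp: imaginary_chords_conj_lines)
    with unique[of T' N'] show "l \<in> {conj_line T N}" by simp
  next
    fix l assume "l \<in> {conj_line T N}"
    with TN show "l \<in> {l \<in> imaginary_chords. l \<subseteq> \<pi>}"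
      by (auto simp: imaginary_chords_conj_lines)
  qed
  then show ?thesis by (simp add: lines_in_def)
qed

text \<open>The planes in \<open>one_bar_planes\<close> fall into classes of size
  \<open>q + 1\<close>, one for each chord: the planes through it.\<close>

lemma card_imaginary_chords:
  "real (card (imaginary_chords :: ('a ^ 4) set set)) = real q * (real q - 1) / 2"
proof -
  let ?IC = "imaginary_chords :: ('a ^ 4) set set" and ?P1 = "one_bar_planes :: ('a ^ 4) set set"
  have "planes_through ?P1 l = q + 1" if l: "l \<in> ?IC" for l
  proof -
    have "{\<pi> \<in> ?P1. l \<subseteq> \<pi>} = {\<pi> \<in> proj_planes. l \<subseteq> \<pi>}"
      using plane_through_imaginary_chord[OF l] by (auto simp: one_bar_planes_def d_planes_def)
    moreover have "vec.subspace l" "vec.dim l = 2"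
      using imaginary_chord_in_external_lines[OF l] by (auto simp: external_lines_def proj_lines_def)
    ultimately show ?thesis
      using card_planes_through[of l] by (simp add: planes_through_def numeral_2_eq_2)
  qed
  then have "card ?IC * (q + 1) = (\<Sum>l\<in>?IC. planes_through ?P1 l)" by simp
  also have "\<dots> = (\<Sum>\<pi>\<in>?P1. lines_in ?IC \<pi>)"
    unfolding planes_through_def lines_in_def by (intro sum_multicount_gen) auto
  also have "\<dots> = card ?P1" using imaginary_chords_in_one_bar_plane by simp
  finally have "real (card ?IC) * (real q + 1) = real (card ?P1)"
    by (metis of_nat_1 of_nat_add of_nat_mult)
  then have "real (card ?IC) * (real q + 1) = real q * (real q - 1) / 2 * (real q + 1)"
    using card_planes(3) by (simp add: mult_ac)
  then show ?thesis by (subst (asm) mult_cancel_right) auto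
qed

lemma imaginary_chord_not_in_Gamma_plane:
  assumes "(l :: ('a ^ 4) set) \<in> imaginary_chords" "\<pi> \<in> Gamma_planes"
  shows "\<not> l \<subseteq> \<pi>"
  using plane_through_imaginary_chord[OF assms(1), of \<pi>] assms(2)
  by (auto simp: Gamma_planes_eq[OF three] one_bar_planes_def)

lemma external_lines_partition:
  "external_lines =
    insert Gamma_axis EA_lines \<union> (imaginary_chords \<union> EnGamma_lines :: ('a ^ 4) set set)"
proof -
  have "\<exists>\<pi>\<in>Gamma_planes. (Gamma_axis :: ('a ^ 4) set) \<subseteq> \<pi>"
    by (auto simp: Gamma_axis_def Gamma_planes_def)
  then show ?thesis
    using imaginary_chord_in_external_lines axis_in_external_lines
    by (auto simp: EA_lines_eq EnGamma_lines_def)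
qed

lemma external_lines_disjoint:
  "Gamma_axis \<notin> (EA_lines :: ('a ^ 4) set set)"
  "imaginary_chords \<inter> (EnGamma_lines :: ('a ^ 4) set set) = {}"
  "insert Gamma_axis EA_lines \<inter> (imaginary_chords \<union> EnGamma_lines :: ('a ^ 4) set set) = {}"
proof -
  show "Gamma_axis \<notin> (EA_lines :: ('a ^ 4) set set)" by (simp add: EA_lines_def)
  show "imaginary_chords \<inter> (EnGamma_lines :: ('a ^ 4) set set) = {}" by (auto simp: EnGamma_lines_def)
  have "\<exists>\<pi>\<in>Gamma_planes. l \<subseteq> \<pi>" if "l \<in> insert Gamma_axis EA_lines" for l :: "('a ^ 4) set"
    using that by (auto simp: EA_lines_eq) (auto simp: Gamma_axis_def Gamma_planes_def)
  then show "insert Gamma_axis EA_lines \<inter> (imaginary_chords \<union> EnGamma_lines :: ('a ^ 4) set set) = {}"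
    using imaginary_chord_not_in_Gamma_plane unfolding EnGamma_lines_def by blast
qed

lemma card_EnGamma_lines:
  "real (card (EnGamma_lines :: ('a ^ 4) set set)) = real q * (real q - 1)\<^sup>2 * (real q + 1)"
proof -
  have "real (card (external_lines :: ('a ^ 4) set set)) =
      1 + real (card (EA_lines :: ('a ^ 4) set set)) + real (card (imaginary_chords :: ('a ^ 4) set set)) +
      real (card (EnGamma_lines :: ('a ^ 4) set set))"
    unfolding external_lines_partition using external_lines_disjoint by (simp add: card_Un_disjoint)
  then show ?thesis
    unfolding card_external_lines card_EA_lines
      card_imaginary_chords
    by (simp add: algebra_simps power2_eq_square add_divide_distrib diff_divide_distrib)
qed

text \<open>The axis is not in the plane, so its external lines split into EA-lines, imaginary
  chords and En\<Gamma>-lines. The number of chords stays a parameter, since it is 1 or 0 according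
  to the type of the plane.\<close>

lemma EnGamma_lines_in_plane:
  assumes \<pi>: "\<pi> \<in> proj_planes" "\<pi> \<notin> Gamma_planes"
  shows "real (lines_in EnGamma_lines (\<pi> :: ('a ^ 4) set)) = (real q)\<^sup>2 -
    real (cubic_number \<pi>) * real q + real (cubic_number \<pi> choose 2) - real (lines_in imaginary_chords \<pi>)"
proof -
  let ?in = "\<lambda>L. {l \<in> L. l \<subseteq> \<pi>}"
  have "\<not> Gamma_axis \<subseteq> \<pi>" using \<pi> by (simp add: Gamma_planes_eq[OF three])
  then have "?in external_lines = ?in EA_lines \<union> (?in imaginary_chords \<union> ?in EnGamma_lines)"
    unfolding external_lines_partition by auto
  moreover have "?in EA_lines \<inter> (?in imaginary_chords \<union> ?in EnGamma_lines) = {}"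
    "?in imaginary_chords \<inter> ?in EnGamma_lines = {}"
    using external_lines_disjoint by auto
  ultimately have "lines_in external_lines \<pi> =
      lines_in EA_lines \<pi> + lines_in imaginary_chords \<pi> + lines_in EnGamma_lines \<pi>"
    by (simp add: lines_in_def card_Un_disjoint)
  from arg_cong[OF this, of real] show ?thesis
    using external_lines_in_plane[OF \<pi>(1)] EA_lines_in_plane[OF \<pi>]
    by (simp add: algebra_simps)
qed

text \<open>Osculating planes and planes through an imaginary chord have exactly one cubic
  point.\<close>

lemma d_plane_not_Gamma:
  assumes "(\<pi> :: ('a ^ 4) set) \<in> d_planes d" "d \<noteq> 1"
  shows "\<pi> \<notin> Gamma_planes" "lines_in imaginary_chords \<pi> = 0"
proof -
  show "\<pi> \<notin> Gamma_planes"
    using assms card_cubic_points_in_Gamma_plane[OF three, of \<pi>] by (auto simp: d_planes_def)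
  have "{l \<in> imaginary_chords. l \<subseteq> \<pi>} = {}"
    using assms plane_through_imaginary_chord by (fastforce simp: d_planes_def one_bar_planes_def simp del: subset_iff)
  then show "lines_in imaginary_chords \<pi> = 0" by (simp add: lines_in_def)
qed

end

theorem theorem6p3:
  fixes q h :: nat
    and EA EnG P3 P1 P0 :: "('a::{field,finite} ^ 4) set set"
  assumes "q = CARD('a)" and "q = 3 ^ h" and "q \<ge> 5"
  defines "EA \<equiv> EA_lines" and "EnG \<equiv> EnGamma_lines"
    and "P3 \<equiv> d_planes 3" and "P1 \<equiv> one_bar_planes" and "P0 \<equiv> d_planes 0"
  shows
    "(\<forall>\<pi>\<in>P3. int (lines_in EA \<pi>) = int q - 2) \<and>
     (\<forall>\<pi>\<in>P1. int (lines_in EA \<pi>) = int q) \<and>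
     (\<forall>\<pi>\<in>P0. int (lines_in EA \<pi>) = int q + 1) \<and>
     (\<forall>\<pi>\<in>P3. int (lines_in EnG \<pi>) = (int q)\<^sup>2 - 3 * int q + 3) \<and>
     (\<forall>\<pi>\<in>P1. int (lines_in EnG \<pi>) = (int q)\<^sup>2 - int q - 1) \<and>
     (\<forall>\<pi>\<in>P0. int (lines_in EnG \<pi>) = (int q)\<^sup>2) \<and>
     avg_planes_through P3 EA = real q * (real q - 2) / (6 * (real q + 1)) \<and>
     avg_planes_through P1 EA = (real q)\<^sup>2 / (2 * (real q + 1)) \<and>
     avg_planes_through P0 EA = real q / 3 \<and>
     avg_planes_through P3 EnG = ((real q)\<^sup>2 - 3 * real q + 3) / (6 * (real q - 1)) \<and>
     avg_planes_through P1 EnG = ((real q)\<^sup>2 - real q - 1) / (2 * (real q - 1)) \<and>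
     avg_planes_through P0 EnG = (real q)\<^sup>2 / (3 * (real q - 1))"
proof -
  note q = assms(1-3)
  note defs = EA_def EnG_def P3_def P1_def P0_def
  have P3: "real (lines_in EA \<pi>) = real q - 2" "real (lines_in EnG \<pi>) = (real q)\<^sup>2 - 3 * real q + 3"
    if "\<pi> \<in> P3" for \<pi>
  proof -
    have \<pi>: "\<pi> \<in> proj_planes" "\<pi> \<notin> Gamma_planes" "cubic_number \<pi> = 3" "lines_in imaginary_chords \<pi> = 0"
      using that d_plane_not_Gamma[OF q, of \<pi> 3] by (auto simp: P3_def d_planes_def cubic_number_def)
    show "real (lines_in EA \<pi>) = real q - 2"
      unfolding EA_def EA_lines_in_plane[OF q \<pi>(1,2)] \<pi>(3) by simp
    show "real (lines_in EnG \<pi>) = (real q)\<^sup>2 - 3 * real q + 3"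
      unfolding EnG_def EnGamma_lines_in_plane[OF q \<pi>(1,2)] \<pi>(3,4) by (simp add: choose_2_real)
  qed
  have P1: "real (lines_in EA \<pi>) = real q" "real (lines_in EnG \<pi>) = (real q)\<^sup>2 - real q - 1"
    if "\<pi> \<in> P1" for \<pi>
  proof -
    have \<pi>: "\<pi> \<in> proj_planes" "\<pi> \<notin> Gamma_planes" "cubic_number \<pi> = 1" "lines_in imaginary_chords \<pi> = 1"
      using that imaginary_chords_in_one_bar_plane[OF q, of \<pi>]
      by (auto simp: P1_def one_bar_planes_def d_planes_def cubic_number_def)
    show "real (lines_in EA \<pi>) = real q"
      unfolding EA_def EA_lines_in_plane[OF q \<pi>(1,2)] \<pi>(3) by simp
    show "real (lines_in EnG \<pi>) = (real q)\<^sup>2 - real q - 1"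
      unfolding EnG_def EnGamma_lines_in_plane[OF q \<pi>(1,2)] \<pi>(3,4) by (simp add: choose_2_real)
  qed
  have P0: "real (lines_in EA \<pi>) = real q + 1" "real (lines_in EnG \<pi>) = (real q)\<^sup>2"
    if "\<pi> \<in> P0" for \<pi>
  proof -
    have \<pi>: "\<pi> \<in> proj_planes" "\<pi> \<notin> Gamma_planes" "cubic_number \<pi> = 0" "lines_in imaginary_chords \<pi> = 0"
      using that d_plane_not_Gamma[OF q, of \<pi> 0] by (auto simp: P0_def d_planes_def cubic_number_def)
    show "real (lines_in EA \<pi>) = real q + 1"
      unfolding EA_def EA_lines_in_plane[OF q \<pi>(1,2)] \<pi>(3) by simp
    show "real (lines_in EnG \<pi>) = (real q)\<^sup>2"
      unfolding EnG_def EnGamma_lines_in_plane[OF q \<pi>(1,2)] \<pi>(3,4) by (simp add: choose_2_real)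
  qed
  \<comment> \<open>The counts involve differences and were derived over the reals; this carries
    them back to the integers.\<close>
  have int_real: "int n = i" if "real n = of_int i" for n i
    using that by (metis of_int_eq_iff of_int_of_nat_eq)
  have card: "real (card P3) = (real q + 1) * real q * (real q - 1) / 6"
    "real (card P1) = (real q + 1) * real q * (real q - 1) / 2"
    "real (card P0) = (real q + 1) * real q * (real q - 1) / 3"
    "real (card EA) = (real q + 1) * (real q + 1) * (real q - 1)"
    "real (card EnG) = (real q + 1) * real q * (real q - 1) * (real q - 1)"
    unfolding defs card_planes[OF q] card_EA_lines[OF q] card_EnGamma_lines[OF q]
    by (simp_all add: algebra_simps power2_eq_square)
  have pos: "real q + 1 \<noteq> 0" "real q - 1 \<noteq> 0" "real q \<noteq> 0" using q(3) by auto
  \<comment> \<open>Used with \<open>x = q + 1\<close>, \<open>y = q\<close>,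
    \<open>z = q - 1\<close>, where \<open>c\<close> is the denominator 6, 2 or 3 of the plane count
    and \<open>v\<close> the number of lines per plane.\<close>
  have ratio_EA: "(x * y * z / c) * v / (x * x * z) = y * v / (c * x)"
    and ratio_EnG: "(x * y * z / c) * v / (x * y * z * z) = v / (c * z)"
    if "x \<noteq> 0" "y \<noteq> 0" "z \<noteq> 0" for x y z c v :: real
    using that by (simp_all add: divide_simps)
  have avg: "avg_planes_through P3 EA = real (card P3) * (real q - 2) / real (card EA)"
    "avg_planes_through P1 EA = real (card P1) * real q / real (card EA)"
    "avg_planes_through P0 EA = real (card P0) * (real q + 1) / real (card EA)"
    "avg_planes_through P3 EnG = real (card P3) * ((real q)\<^sup>2 - 3 * real q + 3) / real (card EnG)"
    "avg_planes_through P1 EnG = real (card P1) * ((real q)\<^sup>2 - real q - 1) / real (card EnG)"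
    "avg_planes_through P0 EnG = real (card P0) * (real q)\<^sup>2 / real (card EnG)"
    by (rule avg_planes_through_eq; erule P3 P1 P0)+
  have "\<forall>\<pi>\<in>P3. int (lines_in EA \<pi>) = int q - 2" "\<forall>\<pi>\<in>P1. int (lines_in EA \<pi>) = int q"
    "\<forall>\<pi>\<in>P0. int (lines_in EA \<pi>) = int q + 1"
    "\<forall>\<pi>\<in>P3. int (lines_in EnG \<pi>) = (int q)\<^sup>2 - 3 * int q + 3"
    "\<forall>\<pi>\<in>P1. int (lines_in EnG \<pi>) = (int q)\<^sup>2 - int q - 1"
    "\<forall>\<pi>\<in>P0. int (lines_in EnG \<pi>) = (int q)\<^sup>2"
    using P3 P1 P0 by (auto intro!: int_real)
  moreover have "avg_planes_through P3 EA = real q * (real q - 2) / (6 * (real q + 1))"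
    "avg_planes_through P1 EA = (real q)\<^sup>2 / (2 * (real q + 1))"
    "avg_planes_through P0 EA = real q / 3"
    using pos(1) unfolding avg card ratio_EA[OF pos(1,3,2)] by (simp_all add: power2_eq_square del: distrib_left_numeral)
  moreover have "avg_planes_through P3 EnG = ((real q)\<^sup>2 - 3 * real q + 3) / (6 * (real q - 1))"
    "avg_planes_through P1 EnG = ((real q)\<^sup>2 - real q - 1) / (2 * (real q - 1))"
    "avg_planes_through P0 EnG = (real q)\<^sup>2 / (3 * (real q - 1))"
    unfolding avg card ratio_EnG[OF pos(1,3,2)] by (rule refl)+
  ultimately show ?thesis by blast
qed

end
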